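(* Let $n\ge1$. There are constants $C_1,C_2>0$ and $\alpha>0$ depending on $n$ such that the following holds. Let $u_0\in H^1({\bf R}^n)\cap L^1({\bf R}^n)$ and $u_1\in L^2({\bf R}^n)\cap L^{1,1}({\bf R}^n)$, let $P_1:=\int_{{\bf R}^n}u_1(x)\,dx$, and let $u(t,x)$ be the solution (case $\mu=2$) of $$u_{tt}-\Delta u+2 L u_t=0\ \text{ in }(0,\infty)\times{\bf R}^n,\qquad u(0,x)=u_0(x),\quad u_t(0,x)=u_1(x),\ x\in{\bf R}^n.$$ Then, for all sufficiently large $t$, $$C_1|P_1|\,t^{1-\frac n2}\le\Vert u(t,\cdot)\Vert\le C_2\Big(\Vert u_1\Vert_{1,1}t^{-\frac n2}+\Vert u_0\Vert_1t^{-\frac n2}+|P_1|\,t^{1-\frac n2}+|P_1|e^{-\alpha t}\Big).$$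
   Context: Fourier transform: ${\cal F}_{x\to\xi}(f)(\xi)=\hat f(\xi)=\int_{{\bf R}^n}e^{-ix\cdot\xi}f(x)\,dx$, with inverse ${\cal F}^{-1}_{\xi\to x}$. The operator $L=\log(I+(-\Delta)^{1/2})$ on $L^2({\bf R}^n)$ is the Fourier multiplier $(Lf)(x)={\cal F}^{-1}_{\xi\to x}(\log(1+|\xi|)\hat f(\xi))(x)$ with domain $D(L)=\{f\in L^2:\int(1+\log^2(1+|\xi|))|\hat f(\xi)|^2d\xi<\infty\}$. For $(u_0,u_1)\in H^1({\bf R}^n)\times L^2({\bf R}^n)$ "the solution" is the unique mild solution $u\in C([0,\infty);H^1({\bf R}^n))\cap C^1([0,\infty);L^2({\bf R}^n))$; equivalently, $w(t,\xi)=\hat u(t,\xi)$ (Fourier transform in $x$) solves $w_{tt}+2\log(1+|\xi|)w_t+|\xi|^2w=0$, $w(0,\xi)=\hat u_0(\xi)$, $w_t(0,\xi)=\hat u_1(\xi)$. Norms: $\Vert\cdot\Vert_q$ is the $L^q({\bf R}^n)$-norm, $\Vert\cdot\Vert=\Vert\cdot\Vert_2$, and $L^{1,1}({\bf R}^n)=\{f\in L^1:\Vert f\Vert_{1,1}:=\int_{{\bf R}^n}(1+|x|)|f(x)|dx<\infty\}$. "Sufficiently large $t$" means $t\ge t_0$ for some $t_0>0$, which may depend on the data. *)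

theory Defs
  imports "HOL-Analysis.Analysis"
begin

text \<open>
  Functions on \<open>\<real>\<^sup>n\<close> are complex-valued functions on \<^typ>\<open>real ^ 'n\<close>, so the dimension is
  \<open>CARD('n)\<close>.  An element of a Lebesgue space is given by a Borel representative; equality in these
  spaces is equality almost everywhere.
\<close>

definition Lspace :: "real \<Rightarrow> (real ^ 'n \<Rightarrow> complex) set" where
  "Lspace q = {f \<in> borel_measurable lborel. integrable lborel (\<lambda>x. norm (f x) powr q)}"

definition Lnorm :: "real \<Rightarrow> (real ^ 'n \<Rightarrow> complex) \<Rightarrow> real" where
  "Lnorm q f = (LINT x|lborel. norm (f x) powr q) powr (1 / q)"

definition L11_space :: "(real ^ 'n \<Rightarrow> complex) set" where
  "L11_space = {f \<in> Lspace 1. integrable lborel (\<lambda>x. (1 + norm x) * norm (f x))}"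

definition L11_norm :: "(real ^ 'n \<Rightarrow> complex) \<Rightarrow> real" where
  "L11_norm f = (LINT x|lborel. (1 + norm x) * norm (f x))"

definition fourier :: "(real ^ 'n \<Rightarrow> complex) \<Rightarrow> real ^ 'n \<Rightarrow> complex" where
  "fourier f \<xi> = (LINT x|lborel. exp (- \<i> * complex_of_real (x \<bullet> \<xi>)) * f x)"

text \<open>
  The Fourier transform on \<open>L\<^sup>2\<close>, as the \<open>L\<^sup>2\<close>-limit of the transforms of the truncations of \<open>f\<close>
  to balls (which lie in \<open>L\<^sup>1 \<inter> L\<^sup>2\<close>).  It is determined only up to null sets, hence a relation.
\<close>

definition has_L2_fourier ::
    "(real ^ 'n \<Rightarrow> complex) \<Rightarrow> (real ^ 'n \<Rightarrow> complex) \<Rightarrow> bool" where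
  "has_L2_fourier f g \<longleftrightarrow> f \<in> Lspace 2 \<and> g \<in> Lspace 2 \<and>
     ((\<lambda>R. Lnorm 2 (\<lambda>\<xi>. fourier (\<lambda>x. indicator (ball 0 R) x * f x) \<xi> - g \<xi>)) \<longlongrightarrow> 0) at_top"

definition L2_fourier :: "(real ^ 'n \<Rightarrow> complex) \<Rightarrow> real ^ 'n \<Rightarrow> complex" where
  "L2_fourier f = (SOME g. has_L2_fourier f g)"

definition H1_space :: "(real ^ 'n \<Rightarrow> complex) set" where
  "H1_space = {f \<in> Lspace 2.
     integrable lborel (\<lambda>\<xi>. (1 + (norm \<xi>)\<^sup>2) * (norm (L2_fourier f \<xi>))\<^sup>2)}"

definition H1_norm :: "(real ^ 'n \<Rightarrow> complex) \<Rightarrow> real" where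
  "H1_norm f = sqrt (LINT \<xi>|lborel. (1 + (norm \<xi>)\<^sup>2) * (norm (L2_fourier f \<xi>))\<^sup>2)"

definition continuous_H1 :: "(real \<Rightarrow> real ^ 'n \<Rightarrow> complex) \<Rightarrow> bool" where
  "continuous_H1 u \<longleftrightarrow> (\<forall>t\<ge>0. u t \<in> H1_space \<and>
     ((\<lambda>s. H1_norm (\<lambda>x. u s x - u t x)) \<longlongrightarrow> 0) (at t within {0..}))"

definition continuous_L2 :: "(real \<Rightarrow> real ^ 'n \<Rightarrow> complex) \<Rightarrow> bool" where
  "continuous_L2 u \<longleftrightarrow> (\<forall>t\<ge>0. u t \<in> Lspace 2 \<and>
     ((\<lambda>s. Lnorm 2 (\<lambda>x. u s x - u t x)) \<longlongrightarrow> 0) (at t within {0..}))"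

definition C1_L2 ::
    "(real \<Rightarrow> real ^ 'n \<Rightarrow> complex) \<Rightarrow> (real \<Rightarrow> real ^ 'n \<Rightarrow> complex) \<Rightarrow> bool" where
  \<comment> \<open>\<open>u\<close> is of class \<open>C\<^sup>1([0,\<infinity>); L\<^sup>2)\<close> with derivative \<open>v\<close>\<close>
  "C1_L2 u v \<longleftrightarrow> (\<forall>t\<ge>0. u t \<in> Lspace 2) \<and> continuous_L2 v \<and>
     (\<forall>t\<ge>0. ((\<lambda>s. Lnorm 2 (\<lambda>x. (u s x - u t x) /\<^sub>R (s - t) - v t x)) \<longlongrightarrow> 0) (at t within {0..}))"

text \<open>The symbol of the Fourier multiplier \<open>L = log (I + (-\<Delta>)\<^sup>1\<^sup>/\<^sup>2)\<close>.\<close>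

definition L_symbol :: "real ^ 'n \<Rightarrow> real" where
  "L_symbol \<xi> = ln (1 + norm \<xi>)"

text \<open>
  Mild solutions in \<open>C([0,\<infinity>); H\<^sup>1) \<inter> C\<^sup>1([0,\<infinity>); L\<^sup>2)\<close> of \<open>u\<^sub>t\<^sub>t - \<Delta>u + 2 L u\<^sub>t = 0\<close> with data \<open>u0\<close>, \<open>u1\<close>;
  here \<open>v = u\<^sub>t\<close>.  The equation is imposed on the Fourier side: there are representatives \<open>w t\<close> and
  \<open>w' t\<close> of the transforms of \<open>u t\<close> and \<open>v t\<close> such that, for almost every frequency,
  \<open>w\<^sub>t = w'\<close> and \<open>w\<^sub>t\<^sub>t + 2 log (1 + |\<xi>|) w\<^sub>t + |\<xi>|\<^sup>2 w = 0\<close> for all \<open>t \<ge> 0\<close>.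
\<close>

definition mild_solution ::
    "(real ^ 'n \<Rightarrow> complex) \<Rightarrow> (real ^ 'n \<Rightarrow> complex) \<Rightarrow> (real \<Rightarrow> real ^ 'n \<Rightarrow> complex) \<Rightarrow> bool" where
  "mild_solution u0 u1 u \<longleftrightarrow> continuous_H1 u \<and>
     (\<exists>v. C1_L2 u v \<and> (AE x in lborel. u 0 x = u0 x) \<and> (AE x in lborel. v 0 x = u1 x) \<and>
       (\<exists>w w'.
         (\<forall>t\<ge>0. has_L2_fourier (u t) (w t) \<and> has_L2_fourier (v t) (w' t)) \<and>
         (AE \<xi> in lborel. \<forall>t\<ge>0.
            ((\<lambda>s. w s \<xi>) has_vector_derivative w' t \<xi>) (at t within {0..}) \<and>
            (\<exists>w''. ((\<lambda>s. w' s \<xi>) has_vector_derivative w'') (at t within {0..}) \<and>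
               w'' + 2 * of_real (L_symbol \<xi>) * w' t \<xi> + of_real ((norm \<xi>)\<^sup>2) * w t \<xi> = 0))))"

end

theory Submission
  imports Defs "HOL-Probability.Characteristic_Functions" "HOL-Probability.Sinc_Integral"
begin

text \<open>
  On the Fourier side the equation decouples: for every frequency \<open>\<xi>\<close> with \<open>r = |\<xi>|\<close> the transform
  of the solution is a damped oscillator with damping \<open>a = log (1 + r)\<close> and stiffness \<open>r\<^sup>2\<close>.  As
  \<open>a < r\<close> for \<open>r > 0\<close>, the oscillator is underdamped, and with \<open>\<omega>\<^sup>2 = r\<^sup>2 - a\<^sup>2\<close>
  the transform is
  \<open>(1 + r)\<^sup>-\<^sup>t * (cos (\<omega> t) * u0^ + sin (\<omega> t) / \<omega> * (u1^ + a * u0^))\<close>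
  with \<open>u0^\<close> and \<open>u1^\<close> the transforms of the data (\<open>mild_solution_fourier\<close>).

  The factor \<open>(1 + r)\<^sup>-\<^sup>t\<close> concentrates everything at frequencies of size \<open>1 / t\<close>.  There
  \<open>sin (\<omega> t) / \<omega>\<close> is comparable to \<open>t\<close> because \<open>\<omega> \<le> r\<close>, and \<open>u1^\<close> is
  \<open>P1\<close> up to an error \<open>r * L11_norm u1\<close>, so the transform has the size of \<open>t * P1\<close>, up to terms bounded by
  the norms of the data.  A ball of radius \<open>1 / t\<close> has volume of order \<open>t powr (- n)\<close>, which turns \<open>t * |P1|\<close> into
  \<open>|P1| * t powr (1 - n / 2)\<close> and the bounded terms into \<open>t powr (- n / 2)\<close>.

  For the upper bound no separation of low and high frequencies is made: Bernoulli's
  inequality bounds \<open>(1 + r)\<^sup>-\<^sup>t * (1 + r t)\<close> by a multiple of \<open>1 / (1 + r t) ^ n\<close> for all \<open>r\<close>, as soon as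
  \<open>t \<ge> n + 1\<close> (\<open>powr_minus_le_inverse_power\<close>), and the square of this function of \<open>t * \<xi>\<close> is
  integrable.  For the lower bound only the ball of radius \<open>1 / t\<close> is used, and \<open>t\<close> has to be so large that
  \<open>t * |P1|\<close> dominates the norms of the data.

  The norms of the solution and of its transform are linked by Plancherel's theorem on
  \<open>\<real>\<^sup>n\<close> (\<open>plancherel\<close>).  It rests on the fact that \<open>|fourier f|\<^sup>2\<close> is the transform of the
  autocorrelation of \<open>f\<close>; testing against wide Gaussians recovers the value of the autocorrelation at
  \<open>0\<close>, which is the squared norm of \<open>f\<close>.  The limit exists because translations act continuously on \<open>L\<^sup>2\<close>
  (\<open>L2_translation_tendsto\<close>).
\<close>

section \<open>Affine substitutions and the Gaussian on Euclidean space\<close>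

lemma lborel_integral_affine:
  fixes f :: "'a::euclidean_space \<Rightarrow> 'b::{banach, second_countable_topology}"
  assumes c: "c \<noteq> 0"
  shows "(LINT x|lborel. f x) = \<bar>c\<bar> ^ DIM('a) *\<^sub>R (LINT x|lborel. f (t + c *\<^sub>R x))"
proof (cases "f \<in> borel_measurable borel")
  case True
  note [measurable] = True
  show ?thesis
    by (subst lborel_affine[OF c, of t])
      (simp add: integral_density integral_distr)
next
  case False
  have "(\<lambda>x. f (t + c *\<^sub>R x)) \<notin> borel_measurable borel"
  proof
    assume *: "(\<lambda>x. f (t + c *\<^sub>R x)) \<in> borel_measurable borel"
    have "(\<lambda>x. (\<lambda>x. f (t + c *\<^sub>R x)) ((x - t) /\<^sub>R c)) \<in> borel_measurable borel"
      by (rule measurable_compose[OF _ *]) auto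
    then show False using False c by simp
  qed
  with False show ?thesis
    by (subst (1 2) not_integrable_integral_eq) (auto dest: borel_measurable_integrable)
qed

lemma lborel_integrable_affine:
  fixes f :: "'a::euclidean_space \<Rightarrow> 'b::{banach, second_countable_topology}"
  assumes c: "c \<noteq> 0" and f: "integrable lborel f"
  shows "integrable lborel (\<lambda>x. f (t + c *\<^sub>R x))"
proof -
  have [measurable]: "f \<in> borel_measurable borel"
    using borel_measurable_integrable[OF f] by simp
  have "integrable (density (distr lborel borel (\<lambda>x. t + c *\<^sub>R x)) (\<lambda>_. ennreal (\<bar>c\<bar> ^ DIM('a)))) f"
    using f lborel_affine[OF c, of t] by simp
  then have "integrable lborel (\<lambda>x. \<bar>c\<bar> ^ DIM('a) *\<^sub>R f (t + c *\<^sub>R x))"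
    by (subst (asm) integrable_density) (auto simp: integrable_distr_eq)
  from integrable_scaleR_right[OF this, of "1 / \<bar>c\<bar> ^ DIM('a)"] show ?thesis
    using c by simp
qed

lemma
  fixes f :: "'a::euclidean_space \<Rightarrow> 'b::{banach, second_countable_topology}"
  shows lborel_integral_translate: "(LINT x|lborel. f (x + z)) = (LINT x|lborel. f x)"
    and lborel_integrable_translate: "integrable lborel f \<Longrightarrow> integrable lborel (\<lambda>x. f (x + z))"
  using lborel_integral_affine[of 1 f z] lborel_integrable_affine[of 1 f z]
  by (simp_all add: add.commute)

text \<open>
  Lebesgue measure is the product of its coordinate measures, so a tensor product of
  one-dimensional functions integrates factor by factor.  This reduces both the Gaussian
  transform and the integrability of \<open>(1 + |x|)\<^sup>-\<^sup>2\<^sup>n\<close> to dimension one.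
\<close>

lemma
  fixes f :: "'a::euclidean_space \<Rightarrow> real \<Rightarrow> 'b::{real_normed_field, banach, second_countable_topology}"
  assumes f: "\<And>b. b \<in> Basis \<Longrightarrow> integrable lborel (f b)"
  shows lborel_integrable_prod_Basis: "integrable lborel (\<lambda>x. \<Prod>b\<in>Basis. f b (x \<bullet> b))"
    and lborel_integral_prod_Basis:
      "(LINT x|lborel. (\<Prod>b\<in>Basis. f b (x \<bullet> b))) = (\<Prod>b\<in>Basis. LINT x|lborel. f b x)"
proof -
  interpret product_sigma_finite "\<lambda>_::'a. lborel :: real measure" ..
  have [measurable]: "f b \<in> borel_measurable borel" if "b \<in> Basis" for b
    using borel_measurable_integrable[OF f[OF that]] by simp
  have [measurable]: "(\<lambda>y::'a \<Rightarrow> real. \<Sum>b\<in>Basis. y b *\<^sub>R b) \<in> Pi\<^sub>M Basis (\<lambda>_. lborel) \<rightarrow>\<^sub>M borel"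
    by measurable
  have eq: "(\<Prod>b\<in>Basis. f b ((\<Sum>c\<in>Basis. y c *\<^sub>R c) \<bullet> b)) = (\<Prod>b\<in>Basis. f b (y b))"
    for y :: "'a \<Rightarrow> real"
    by (intro prod.cong refl) simp
  show "integrable lborel (\<lambda>x. \<Prod>b\<in>Basis. f b (x \<bullet> b))"
    by (subst lborel_eq, subst integrable_distr_eq)
      (auto simp: eq intro!: product_integrable_prod f)
  show "(LINT x|lborel. (\<Prod>b\<in>Basis. f b (x \<bullet> b))) = (\<Prod>b\<in>Basis. LINT x|lborel. f b x)"
    by (subst lborel_eq, subst integral_distr)
      (auto simp: eq intro!: product_integral_prod f)
qed

text \<open>
  The characteristic function of the standard normal distribution, with the factor
  \<open>sqrt (2 * pi)\<close> that its density carries moved to the other side.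
\<close>

lemma
  shows integrable_exp_neg_half_square: "integrable lborel (\<lambda>x::real. exp (- x\<^sup>2 / 2))"
    and integral_iexp_exp_neg_half_square:
      "(LINT x|lborel. exp (- \<i> * complex_of_real (x * t)) * complex_of_real (exp (- x\<^sup>2 / 2)))
        = complex_of_real (sqrt (2 * pi) * exp (- t\<^sup>2 / 2))"
proof -
  have eq: "exp (- x\<^sup>2 / 2) = sqrt (2 * pi) * std_normal_density x" for x
    by (simp add: std_normal_density_def)
  show "integrable lborel (\<lambda>x::real. exp (- x\<^sup>2 / 2))"
    unfolding eq by (intro integrable_mult_right integrable_normal_density) simp
  have "(LINT x|lborel. exp (- \<i> * complex_of_real (x * t)) * complex_of_real (exp (- x\<^sup>2 / 2)))
      = (LINT x|lborel. complex_of_real (sqrt (2 * pi)) * (std_normal_density x *\<^sub>R iexp (- t * x)))"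
    unfolding eq by (intro Bochner_Integration.integral_cong) (auto simp: scaleR_conv_of_real mult_ac)
  also have "\<dots> = complex_of_real (sqrt (2 * pi)) * (LINT x|lborel. std_normal_density x *\<^sub>R iexp (- t * x))"
    by (rule integral_mult_right_zero)
  also have "(LINT x|lborel. std_normal_density x *\<^sub>R iexp (- t * x)) = char std_normal_distribution (-t)"
    unfolding char_def by (subst integral_density) (auto simp: )
  finally show "(LINT x|lborel. exp (- \<i> * complex_of_real (x * t)) * complex_of_real (exp (- x\<^sup>2 / 2)))
        = complex_of_real (sqrt (2 * pi) * exp (- t\<^sup>2 / 2))"
    unfolding char_std_normal_distribution by simp
qed

lemma exp_neg_half_norm_square:
  fixes x :: "'a::euclidean_space"
  shows "exp (- (norm x)\<^sup>2 / 2) = (\<Prod>b\<in>Basis. exp (- (x \<bullet> b)\<^sup>2 / 2))"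
  by (simp add: exp_sum[symmetric] norm_eq_sqrt_inner euclidean_inner[of x x] sum_nonneg
      sum_negf sum_divide_distrib power2_eq_square)

lemma integrable_gaussian:
  "integrable lborel (\<lambda>x::'a::euclidean_space. exp (- (norm x)\<^sup>2 / 2))"
  unfolding exp_neg_half_norm_square
  by (rule lborel_integrable_prod_Basis[of "\<lambda>_ x. exp (- x\<^sup>2 / 2)"])
    (rule integrable_exp_neg_half_square)

lemma fourier_transform_gaussian:
  fixes \<xi> :: "'a::euclidean_space"
  shows "(LINT x|lborel. exp (- \<i> * complex_of_real (x \<bullet> \<xi>)) * complex_of_real (exp (- (norm x)\<^sup>2 / 2)))
    = complex_of_real (sqrt (2 * pi) ^ DIM('a) * exp (- (norm \<xi>)\<^sup>2 / 2))"
proof -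
  have eq: "exp (- \<i> * complex_of_real (x \<bullet> \<xi>)) * complex_of_real (exp (- (norm x)\<^sup>2 / 2))
      = (\<Prod>b\<in>Basis. exp (- \<i> * complex_of_real ((x \<bullet> b) * (\<xi> \<bullet> b))) * complex_of_real (exp (- (x \<bullet> b)\<^sup>2 / 2)))"
    for x :: 'a
  proof -
    have "exp (- \<i> * complex_of_real (x \<bullet> \<xi>))
        = (\<Prod>b\<in>Basis. exp (- \<i> * complex_of_real ((x \<bullet> b) * (\<xi> \<bullet> b))))"
      unfolding euclidean_inner[of x \<xi>] by (simp add: exp_sum[symmetric] sum_negf sum_distrib_left)
    then show ?thesis
      unfolding exp_neg_half_norm_square prod.distrib by simp
  qed
  show ?thesis
    unfolding eq
    apply (subst lborel_integral_prod_Basis[where f="\<lambda>b y. exp (- \<i> * complex_of_real (y * (\<xi> \<bullet> b))) * complex_of_real (exp (- y\<^sup>2 / 2))"])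
    subgoal for b
      by (rule Bochner_Integration.integrable_bound[OF integrable_exp_neg_half_square])
        (auto simp: norm_mult simp del: of_real_mult)
    unfolding integral_iexp_exp_neg_half_square exp_neg_half_norm_square[of \<xi>]
    by (simp add: prod.distrib)
qed

section \<open>Continuity of translations\<close>

text \<open>
  The density arguments below all end in this form: the sequence of interest is dominated, up to
  an arbitrarily small error, by a null sequence that depends on the error.
\<close>

lemma LIMSEQ_0_up_to_epsilon:
  fixes a :: "nat \<Rightarrow> real"
  assumes nn: "\<And>k. 0 \<le> a k"
    and ap: "\<And>e. e > 0 \<Longrightarrow> \<exists>b. b \<longlonglongrightarrow> 0 \<and> (\<forall>k. a k \<le> b k + e)"
  shows "a \<longlonglongrightarrow> 0"
proof (rule LIMSEQ_I)
  fix e :: real assume e: "e > 0"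
  obtain b where b: "b \<longlonglongrightarrow> 0" and le: "\<And>k. a k \<le> b k + e / 2"
    using ap[of "e / 2"] e by auto
  obtain N where N: "\<And>k. k \<ge> N \<Longrightarrow> \<bar>b k\<bar> < e / 2"
    using LIMSEQ_D[OF b, of "e / 2"] e by auto
  show "\<exists>N. \<forall>k\<ge>N. norm (a k - 0) < e"
  proof (intro exI allI impI)
    fix k assume "N \<le> k"
    with N[of k] le[of k] nn[of k] show "norm (a k - 0) < e" by auto
  qed
qed

text \<open>
  For an open \<open>U\<close> a point of \<open>U\<close> stays in \<open>U\<close> under small translations, so the positive part of
  \<open>indicator U x - indicator U (x + z k)\<close> tends to zero pointwise and is dominated by
  \<open>indicator U\<close>.  Both indicators have the same integral; hence the negative part has the same
  integral as the positive part and tends to zero as well.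
\<close>

lemma indicator_translate_open_tendsto:
  fixes U :: "'a::euclidean_space set"
  assumes U: "open U" and fin: "emeasure lborel U < \<infinity>" and z: "z \<longlonglongrightarrow> 0"
  shows "(\<lambda>k. LINT x|lborel. \<bar>indicator U (x + z k) - indicator U x\<bar> :: real) \<longlonglongrightarrow> 0"
proof -
  let ?I = "indicator U :: 'a \<Rightarrow> real"
  have [measurable]: "U \<in> sets borel" using U by simp
  have int: "integrable lborel ?I" using fin by simp
  have int': "integrable lborel (\<lambda>x. ?I (x + w))" for w
    by (rule lborel_integrable_translate[OF int])
  have "(\<lambda>k. LINT x|lborel. max 0 (?I x - ?I (x + z k))) \<longlonglongrightarrow> (LINT x::'a|lborel. (0::real))"
  proof (rule integral_dominated_convergence[where w="?I"])
    show "AE x in lborel. (\<lambda>k. max 0 (?I x - ?I (x + z k))) \<longlonglongrightarrow> 0"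
    proof (rule AE_I2)
      fix x :: 'a
      show "(\<lambda>k. max 0 (?I x - ?I (x + z k))) \<longlonglongrightarrow> 0"
      proof (cases "x \<in> U")
        case True
        have "(\<lambda>k. x + z k) \<longlonglongrightarrow> x + 0" by (intro tendsto_intros z)
        then have "eventually (\<lambda>k. x + z k \<in> U) sequentially"
          using True U by (auto dest: topological_tendstoD)
        then have "eventually (\<lambda>k. max 0 (?I x - ?I (x + z k)) = 0) sequentially"
          by eventually_elim (use True in auto)
        then show ?thesis by (rule tendsto_eventually)
      next
        case False
        then show ?thesis by (auto simp: indicator_def)
      qed
    qed
  qed (use int in \<open>auto simp: indicator_def\<close>)
  then have lim: "(\<lambda>k. 2 * (LINT x|lborel. max 0 (?I x - ?I (x + z k)))) \<longlonglongrightarrow> 0"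
    using tendsto_mult_right_zero by fastforce
  have "(LINT x|lborel. \<bar>?I (x + z k) - ?I x\<bar>) = 2 * (LINT x|lborel. max 0 (?I x - ?I (x + z k)))" for k
  proof -
    have "(LINT x|lborel. \<bar>?I (x + z k) - ?I x\<bar>)
        = (LINT x|lborel. 2 * max 0 (?I x - ?I (x + z k)) + (?I (x + z k) - ?I x))"
      by (intro Bochner_Integration.integral_cong) (auto simp: indicator_def)
    also have "\<dots> = (LINT x|lborel. 2 * max 0 (?I x - ?I (x + z k))) + (LINT x|lborel. ?I (x + z k) - ?I x)"
      by (intro Bochner_Integration.integral_add Bochner_Integration.integrable_diff int int'
          integrable_mult_right integrable_max integrable_zero)
    also have "(LINT x|lborel. ?I (x + z k) - ?I x) = 0"
      by (subst Bochner_Integration.integral_diff[OF int' int]) (simp add: lborel_integral_translate[of ?I])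
    finally show ?thesis by simp
  qed
  with lim show ?thesis by simp
qed

text \<open>
  Density argument: outer regularity replaces a set of finite measure by an open set with a small
  error, and the error is unaffected by translations.  Linear combinations and dominated limits
  then reach every integrable function.
\<close>

lemma L1_translation_tendsto:
  fixes f :: "'a::euclidean_space \<Rightarrow> 'b::{banach, second_countable_topology}"
  assumes f: "integrable lborel f" and z: "z \<longlonglongrightarrow> 0"
  shows "(\<lambda>k. LINT x|lborel. norm (f (x + z k) - f x)) \<longlonglongrightarrow> 0"
  using f
proof (induction rule: integrable_induct)
  case (base A c)
  then have A [measurable]: "A \<in> sets borel" by simp
  show ?case
  proof (rule LIMSEQ_0_up_to_epsilon)
    fix e :: real assume e: "e > 0"
    \<comment> \<open>the set \<open>U - A\<close> is counted twice, at \<open>x\<close> and at \<open>x + z k\<close>, each time with weight \<open>norm c\<close>\<close>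
    define d where "d = e / (2 * (norm c + 1))"
    have d: "d > 0" using e by (simp add: d_def add_nonneg_pos)
    have "norm c + 1 \<noteq> 0" using norm_ge_zero[of c] by linarith
    then have e_d: "e = d * (2 * (norm c + 1))" by (simp add: d_def)
    obtain U where U: "open U" "A \<subseteq> U" "emeasure lborel (U - A) < ennreal d"
      using outer_regular_lborel[OF A d] by blast
    have [measurable]: "U \<in> sets borel" using U by simp
    have finD: "emeasure lborel (U - A) < \<infinity>"
      using U(3) by (metis ennreal_less_top infinity_ennreal_def order_less_trans)
    have "emeasure lborel U \<le> emeasure lborel A + emeasure lborel (U - A)"
      using emeasure_subadditive[of A lborel "U - A"] U(2) by (simp add: Un_absorb1)
    also have "\<dots> < \<infinity>" using base(2) finD by simp
    finally have finU: "emeasure lborel U < \<infinity>" .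
    let ?U = "indicator U :: 'a \<Rightarrow> real" and ?D = "indicator (U - A) :: 'a \<Rightarrow> real"
    have intU: "integrable lborel ?U" and intD: "integrable lborel ?D"
      using finU finD by simp_all
    have mD: "(LINT x|lborel. ?D x) \<le> d"
      using U(3) d by (simp add: measure_def enn2real_leI)
    define b where "b k = norm c * (LINT x|lborel. \<bar>?U (x + z k) - ?U x\<bar>)" for k
    have "b \<longlonglongrightarrow> 0"
      unfolding b_def by (intro tendsto_mult_right_zero indicator_translate_open_tendsto U finU z)
    moreover have "(LINT x|lborel. norm (indicator A (x + z k) *\<^sub>R c - indicator A x *\<^sub>R c)) \<le> b k + e" for k
    proof -
      have intA: "integrable lborel (\<lambda>x. indicator A x *\<^sub>R c)"
        using base by (intro integrable_scaleR_left) simp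
      have "(LINT x|lborel. norm (indicator A (x + z k) *\<^sub>R c - indicator A x *\<^sub>R c))
          \<le> (LINT x|lborel. norm c * (\<bar>?U (x + z k) - ?U x\<bar> + (?D (x + z k) + ?D x)))"
      proof (rule integral_mono)
        show "integrable lborel (\<lambda>x. norm (indicator A (x + z k) *\<^sub>R c - indicator A x *\<^sub>R c))"
          by (intro integrable_norm Bochner_Integration.integrable_diff intA
              lborel_integrable_translate[OF intA])
        show "integrable lborel (\<lambda>x. norm c * (\<bar>?U (x + z k) - ?U x\<bar> + (?D (x + z k) + ?D x)))"
          by (intro integrable_mult_right Bochner_Integration.integrable_add integrable_abs
              Bochner_Integration.integrable_diff intU intD
              lborel_integrable_translate[OF intU] lborel_integrable_translate[OF intD])
        show "norm (indicator A (x + z k) *\<^sub>R c - indicator A x *\<^sub>R c)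
            \<le> norm c * (\<bar>?U (x + z k) - ?U x\<bar> + (?D (x + z k) + ?D x))" for x
          using U(2) by (auto simp: indicator_def)
      qed
      also have "\<dots> = norm c * ((LINT x|lborel. \<bar>?U (x + z k) - ?U x\<bar>)
          + ((LINT x|lborel. ?D (x + z k)) + (LINT x|lborel. ?D x)))"
        by (subst integral_mult_right_zero, subst Bochner_Integration.integral_add,
            (intro Bochner_Integration.integrable_add integrable_abs
              Bochner_Integration.integrable_diff intU intD
              lborel_integrable_translate[OF intU] lborel_integrable_translate[OF intD])+,
            subst Bochner_Integration.integral_add,
            (intro intD lborel_integrable_translate[OF intD])+, rule refl)
      also have "\<dots> = b k + norm c * 2 * (LINT x|lborel. ?D x)"
        unfolding lborel_integral_translate b_def by (simp add: algebra_simps)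
      also have "\<dots> \<le> b k + norm c * 2 * d"
        using mD by (intro add_left_mono mult_left_mono) auto
      also have "norm c * 2 * d \<le> e"
        using d e_d by (simp add: algebra_simps)
      finally show ?thesis by simp
    qed
    ultimately show "\<exists>b. b \<longlonglongrightarrow> 0 \<and>
        (\<forall>k. (LINT x|lborel. norm (indicator A (x + z k) *\<^sub>R c - indicator A x *\<^sub>R c)) \<le> b k + e)"
      by blast
  qed simp
next
  case (add f g)
  show ?case
  proof (rule real_tendsto_sandwich[OF _ _ tendsto_const tendsto_add_zero[OF add.IH]])
    show "\<forall>\<^sub>F k in sequentially. (LINT x|lborel. norm (f (x + z k) + g (x + z k) - (f x + g x)))
        \<le> (LINT x|lborel. norm (f (x + z k) - f x)) + (LINT x|lborel. norm (g (x + z k) - g x))"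
    proof (rule always_eventually, rule allI)
      fix k
      note i = add.hyps add.hyps[THEN lborel_integrable_translate]
      have "(LINT x|lborel. norm (f (x + z k) + g (x + z k) - (f x + g x)))
          \<le> (LINT x|lborel. norm (f (x + z k) - f x) + norm (g (x + z k) - g x))"
        by (rule integral_mono) (use i norm_diff_triangle_ineq in auto)
      then show "(LINT x|lborel. norm (f (x + z k) + g (x + z k) - (f x + g x)))
          \<le> (LINT x|lborel. norm (f (x + z k) - f x)) + (LINT x|lborel. norm (g (x + z k) - g x))"
        using i by simp
    qed
  qed simp
next
  case (lim f s)
  show ?case
  proof (rule LIMSEQ_0_up_to_epsilon)
    fix e :: real assume e: "e > 0"
    have [measurable]: "s i \<in> borel_measurable borel" "f \<in> borel_measurable borel" for i
      using lim.hyps(1,4)[THEN borel_measurable_integrable] by auto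
    have "(\<lambda>i. LINT x|lborel. norm (s i x - f x)) \<longlonglongrightarrow> (LINT x|lborel. norm (f x - f x))"
    proof (rule integral_dominated_convergence[where w="\<lambda>x. 3 * norm (f x)"])
      show "AE x in lborel. (\<lambda>i. norm (s i x - f x)) \<longlonglongrightarrow> norm (f x - f x)"
        using lim.hyps(2) by (intro AE_I2 tendsto_intros) auto
      show "AE x in lborel. norm (norm (s i x - f x)) \<le> 3 * norm (f x)" for i
      proof (rule AE_I2)
        fix x
        show "norm (norm (s i x - f x)) \<le> 3 * norm (f x)"
          using norm_triangle_ineq4[of "s i x" "f x"] lim.hyps(3)[of x i] by simp
      qed
    qed (use lim.hyps(4) in auto)
    then have "(\<lambda>i. LINT x|lborel. norm (s i x - f x)) \<longlonglongrightarrow> 0" by simp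
    from LIMSEQ_D[OF this, of "e / 2"] e
    obtain i where i: "(LINT x|lborel. norm (s i x - f x)) < e / 2" by auto
    note int = lim.hyps(1)[of i] lim.hyps(4)
    note int' = int lborel_integrable_translate[OF int(1)] lborel_integrable_translate[OF int(2)]
    have "(LINT x|lborel. norm (f (x + z k) - f x)) \<le> (LINT x|lborel. norm (s i (x + z k) - s i x)) + e" for k
    proof -
      have "(LINT x|lborel. norm (f (x + z k) - f x)) \<le>
          (LINT x|lborel. norm (s i (x + z k) - s i x) + (norm (s i (x + z k) - f (x + z k)) + norm (s i x - f x)))"
      proof (rule integral_mono)
        show "norm (f (x + z k) - f x) \<le>
          norm (s i (x + z k) - s i x) + (norm (s i (x + z k) - f (x + z k)) + norm (s i x - f x))" for x
          by norm
      qed (use int' in auto)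
      also have "\<dots> = (LINT x|lborel. norm (s i (x + z k) - s i x)) + 2 * (LINT x|lborel. norm (s i x - f x))"
        using lborel_integral_translate[of "\<lambda>x. norm (s i x - f x)" "z k"] int'
        by simp
      finally show ?thesis using i by simp
    qed
    with lim.IH[of i]
    show "\<exists>b. b \<longlonglongrightarrow> 0 \<and> (\<forall>k. (LINT x|lborel. norm (f (x + z k) - f x)) \<le> b k + e)"
      by blast
  qed simp
qed

lemma norm_add_square_le:
  fixes a b :: "'a::real_normed_vector"
  shows "(norm (a + b))\<^sup>2 \<le> 2 * (norm a)\<^sup>2 + 2 * (norm b)\<^sup>2"
proof -
  have "(norm (a + b))\<^sup>2 \<le> (norm a + norm b)\<^sup>2"
    by (intro power_mono norm_triangle_ineq) simp
  also have "\<dots> \<le> 2 * (norm a)\<^sup>2 + 2 * (norm b)\<^sup>2"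
    using zero_le_power2[of "norm a - norm b"] by (simp add: power2_eq_square algebra_simps)
  finally show ?thesis .
qed

lemma L2_truncation_tendsto:
  fixes f :: "'a::euclidean_space \<Rightarrow> 'b::{banach, second_countable_topology}"
  assumes f[measurable]: "f \<in> borel_measurable lborel" and f2: "integrable lborel (\<lambda>x. (norm (f x))\<^sup>2)"
    and A[measurable]: "\<And>k. A k \<in> sets lborel"
    and ev: "\<And>x. eventually (\<lambda>k::nat. x \<in> A k) sequentially"
  shows "(\<lambda>k. LINT x|lborel. (norm (f x - indicator (A k) x *\<^sub>R f x))\<^sup>2) \<longlonglongrightarrow> 0"
proof -
  have "(\<lambda>k. LINT x|lborel. (norm (f x - indicator (A k) x *\<^sub>R f x))\<^sup>2) \<longlonglongrightarrow> (LINT x::'a|lborel. (0::real))"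
  proof (rule integral_dominated_convergence[where w="\<lambda>x. (norm (f x))\<^sup>2"])
    show "AE x in lborel. (\<lambda>k. (norm (f x - indicator (A k) x *\<^sub>R f x))\<^sup>2) \<longlonglongrightarrow> 0"
    proof (rule AE_I2)
      fix x
      have "eventually (\<lambda>k. (norm (f x - indicator (A k) x *\<^sub>R f x))\<^sup>2 = 0) sequentially"
        using ev[of x] by eventually_elim simp
      then show "(\<lambda>k. (norm (f x - indicator (A k) x *\<^sub>R f x))\<^sup>2) \<longlonglongrightarrow> 0"
        by (rule tendsto_eventually)
    qed
    show "AE x in lborel. norm ((norm (f x - indicator (A k) x *\<^sub>R f x))\<^sup>2) \<le> (norm (f x))\<^sup>2" for k
      by (auto simp: indicator_def)
  qed (use f2 in auto)
  then show ?thesis by simp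
qed

text \<open>
  For a bounded integrable \<open>g\<close> with \<open>|g| \<le> M\<close> one has
  \<open>|g (x + z) - g x|\<^sup>2 \<le> 2 M |g (x + z) - g x|\<close>, so the case of \<open>L\<^sup>1\<close> applies.
  The general case follows by cutting \<open>f\<close> off where \<open>|f|\<close> is large, which costs little in \<open>L\<^sup>2\<close>.
\<close>

lemma L2_translation_tendsto:
  fixes f :: "'a::euclidean_space \<Rightarrow> 'b::{banach, second_countable_topology}"
  assumes f1: "integrable lborel f" and f2: "integrable lborel (\<lambda>x. (norm (f x))\<^sup>2)"
    and z: "z \<longlonglongrightarrow> 0"
  shows "(\<lambda>k. LINT x|lborel. (norm (f (x + z k) - f x))\<^sup>2) \<longlonglongrightarrow> 0"
proof (rule LIMSEQ_0_up_to_epsilon)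
  fix e :: real assume e: "e > 0"
  have [measurable]: "f \<in> borel_measurable borel" using borel_measurable_integrable[OF f1] by simp
  define A where "A k = {x. norm (f x) \<le> real k}" for k
  have [measurable]: "A k \<in> sets borel" for k unfolding A_def by measurable
  have "(\<lambda>k. LINT x|lborel. (norm (f x - indicator (A k) x *\<^sub>R f x))\<^sup>2) \<longlonglongrightarrow> 0"
  proof (rule L2_truncation_tendsto[OF _ f2])
    show "eventually (\<lambda>k. x \<in> A k) sequentially" for x
      using eventually_ge_at_top[of "nat \<lceil>norm (f x)\<rceil>"] unfolding A_def
      by eventually_elim (auto simp: nat_le_iff ceiling_le_iff)
  qed auto
  from LIMSEQ_D[OF this, of "e / 8"] e
  obtain M where M: "(LINT x|lborel. (norm (f x - indicator (A M) x *\<^sub>R f x))\<^sup>2) < e / 8" by auto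
  define g where "g x = indicator (A M) x *\<^sub>R f x" for x
  have [measurable]: "g \<in> borel_measurable borel" unfolding g_def by measurable
  have g1: "integrable lborel g"
    by (rule Bochner_Integration.integrable_bound[OF f1]) (auto simp: g_def indicator_def)
  have gM: "norm (g x) \<le> M" for x by (auto simp: g_def A_def indicator_def)
  define h where "h x = (norm (f x - g x))\<^sup>2" for x
  have h: "integrable lborel h"
    unfolding h_def by (rule Bochner_Integration.integrable_bound[OF f2]) (auto simp: g_def indicator_def)
  have hM: "(LINT x|lborel. h x) < e / 8" using M by (simp add: h_def g_def)
  define b where "b k = 4 * real M * (LINT x|lborel. norm (g (x + z k) - g x))" for k
  have "b \<longlonglongrightarrow> 0"
    unfolding b_def by (intro tendsto_mult_right_zero L1_translation_tendsto g1 z)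
  moreover have "(LINT x|lborel. (norm (f (x + z k) - f x))\<^sup>2) \<le> b k + e" for k
  proof -
    have g': "integrable lborel (\<lambda>x. norm (g (x + z k) - g x))"
      by (intro integrable_norm Bochner_Integration.integrable_diff g1 lborel_integrable_translate)
    note h' = lborel_integrable_translate[OF h]
    have pt: "(norm (f (x + z k) - f x))\<^sup>2
        \<le> 4 * real M * norm (g (x + z k) - g x) + 4 * (h (x + z k) + h x)" for x
    proof -
      let ?a = "g (x + z k) - g x" and ?b = "f (x + z k) - g (x + z k)" and ?c = "g x - f x"
      have "(norm (f (x + z k) - f x))\<^sup>2 \<le> 2 * (norm ?a)\<^sup>2 + 2 * (norm (?b + ?c))\<^sup>2"
        using norm_add_square_le[of ?a "?b + ?c"] by (simp add: algebra_simps)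
      also have "(norm (?b + ?c))\<^sup>2 \<le> 2 * h (x + z k) + 2 * h x"
        using norm_add_square_le[of ?b ?c] by (simp add: h_def norm_minus_commute)
      also have "(norm ?a)\<^sup>2 \<le> 2 * real M * norm ?a"
        unfolding power2_eq_square
        using norm_triangle_ineq4[of "g (x + z k)" "g x"] gM[of x] gM[of "x + z k"]
        by (intro mult_right_mono) auto
      finally show ?thesis by simp
    qed
    have i: "integrable lborel (\<lambda>x. 4 * real M * norm (g (x + z k) - g x) + 4 * (h (x + z k) + h x))"
      using g' h h' by auto
    have "(LINT x|lborel. (norm (f (x + z k) - f x))\<^sup>2)
        \<le> (LINT x|lborel. 4 * real M * norm (g (x + z k) - g x) + 4 * (h (x + z k) + h x))"
      by (intro integral_mono i Bochner_Integration.integrable_bound[OF i])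
        (auto intro!: order_trans[OF pt])
    also have "\<dots> = b k + 8 * (LINT x|lborel. h x)"
      using g' h h' lborel_integral_translate[of h "z k"] by (simp add: b_def)
    finally show ?thesis using hM by simp
  qed
  ultimately show "\<exists>b. b \<longlonglongrightarrow> 0 \<and> (\<forall>k. (LINT x|lborel. (norm (f (x + z k) - f x))\<^sup>2) \<le> b k + e)"
    by blast
qed simp

section \<open>Plancherel's identity for integrable functions\<close>

lemma borel_measurable_cnj [measurable (raw)]:
  "f \<in> borel_measurable M \<Longrightarrow> (\<lambda>x. cnj (f x)) \<in> borel_measurable M"
  by (rule borel_measurable_continuous_on[where f=cnj]) (intro continuous_intros)

lemma borel_measurable_fourier:
  assumes [measurable]: "f \<in> borel_measurable borel"
  shows "fourier f \<in> borel_measurable borel"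
  unfolding fourier_def by measurable

lemma integrable_exp_times:
  fixes f :: "'a::euclidean_space \<Rightarrow> complex"
  assumes f: "integrable lborel f"
  shows "integrable lborel (\<lambda>x. exp (- \<i> * complex_of_real (x \<bullet> \<xi>)) * f x)"
proof -
  have [measurable]: "f \<in> borel_measurable borel" using borel_measurable_integrable[OF f] by simp
  show ?thesis
    by (rule Bochner_Integration.integrable_bound[OF f]) (auto simp: norm_mult)
qed

lemma norm_fourier_le:
  "norm (fourier f \<xi>) \<le> (LINT x|lborel. norm (f x))"
  unfolding fourier_def
  using integral_norm_bound[of lborel "\<lambda>x. exp (- \<i> * complex_of_real (x \<bullet> \<xi>)) * f x"]
  by (simp add: norm_mult)

text \<open>
  Both sides are the double integral of \<open>exp (- i x \<bullet> \<xi>) f x g \<xi>\<close>.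
\<close>

lemma fourier_multiplication:
  fixes f g :: "real ^ 'n \<Rightarrow> complex"
  assumes f: "integrable lborel f" and g: "integrable lborel g"
  shows "(LINT \<xi>|lborel. fourier f \<xi> * g \<xi>) = (LINT x|lborel. f x * fourier g x)"
proof -
  have [measurable]: "f \<in> borel_measurable borel" "g \<in> borel_measurable borel"
    using borel_measurable_integrable[OF f] borel_measurable_integrable[OF g] by auto
  define h where "h x \<xi> = f x * (exp (- \<i> * complex_of_real (x \<bullet> \<xi>)) * g \<xi>)" for x \<xi>
  have "integrable (lborel \<Otimes>\<^sub>M lborel) (case_prod h)"
  proof (rule lborel_pair.Fubini_integrable)
    show "case_prod h \<in> borel_measurable (lborel \<Otimes>\<^sub>M lborel)"
      unfolding h_def by measurable
    show "integrable lborel (\<lambda>x. LINT y|lborel. norm (case_prod h (x, y)))"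
      using f by (simp add: h_def norm_mult)
    show "AE x in lborel. integrable lborel (\<lambda>y. case_prod h (x, y))"
    proof (rule AE_I2)
      fix x :: "real ^ 'n"
      have "integrable lborel (\<lambda>\<xi>. exp (- \<i> * complex_of_real (x \<bullet> \<xi>)) * g \<xi>)"
        using integrable_exp_times[OF g, of x] by (simp add: inner_commute)
      then show "integrable lborel (\<lambda>y. case_prod h (x, y))" by (simp add: h_def)
    qed
  qed
  from lborel_pair.Fubini_integral[OF this]
  have "(LINT \<xi>|lborel. LINT x|lborel. h x \<xi>) = (LINT x|lborel. LINT \<xi>|lborel. h x \<xi>)" .
  moreover have "(LINT x|lborel. h x \<xi>) = fourier f \<xi> * g \<xi>" for \<xi>
    unfolding fourier_def h_def
    by (subst integral_mult_left_zero[symmetric]) (simp add: mult_ac)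
  moreover have "(LINT \<xi>|lborel. h x \<xi>) = f x * fourier g x" for x
    unfolding fourier_def h_def integral_mult_right_zero by (simp add: inner_commute)
  ultimately show ?thesis by simp
qed

definition autocorrelation :: "(real ^ 'n \<Rightarrow> complex) \<Rightarrow> real ^ 'n \<Rightarrow> complex" where
  "autocorrelation f z = (LINT x|lborel. f (x + z) * cnj (f x))"

text \<open>
  Since \<open>z = (x + z) - x\<close>, the exponential splits as
  \<open>exp (- i z \<bullet> \<xi>) = exp (- i (x + z) \<bullet> \<xi>) * cnj (exp (- i x \<bullet> \<xi>))\<close>, and after Fubini
  the inner integral is a translate of the one that defines \<open>fourier f\<close>.
\<close>

lemma
  fixes f :: "real ^ 'n \<Rightarrow> complex"
  assumes f: "integrable lborel f"
  shows integrable_autocorrelation: "integrable lborel (autocorrelation f)"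
    and fourier_autocorrelation: "fourier (autocorrelation f) \<xi> = complex_of_real ((norm (fourier f \<xi>))\<^sup>2)"
proof -
  have [measurable]: "f \<in> borel_measurable borel"
    using borel_measurable_integrable[OF f] by auto
  define h where "h x z = cnj (f x) * f (x + z)" for x z
  have ft: "integrable lborel (\<lambda>z. f (x + z))" for x
    using lborel_integrable_translate[OF f, of x] by (simp add: add.commute)
  have ti: "(LINT z|lborel. g (x + z)) = (LINT z|lborel. g z)"
    for g :: "real ^ 'n \<Rightarrow> 'c::{banach, second_countable_topology}" and x
    using lborel_integral_translate[of g x] by (simp add: add.commute)
  have int: "integrable (lborel \<Otimes>\<^sub>M lborel) (case_prod h)"
  proof (rule lborel_pair.Fubini_integrable)
    show "case_prod h \<in> borel_measurable (lborel \<Otimes>\<^sub>M lborel)"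
      unfolding h_def by measurable
    show "integrable lborel (\<lambda>x. LINT y|lborel. norm (case_prod h (x, y)))"
      using f by (simp add: h_def norm_mult ti[of "\<lambda>z. norm (f z)"])
    show "AE x in lborel. integrable lborel (\<lambda>y. case_prod h (x, y))"
      using ft by (simp add: h_def)
  qed
  have "integrable lborel (\<lambda>z. LINT x|lborel. h x z)"
    using lborel_pair.integrable_snd[OF int] by simp
  then show "integrable lborel (autocorrelation f)"
    unfolding autocorrelation_def h_def by (simp add: mult.commute)
  define k where "k x z = exp (- \<i> * complex_of_real (z \<bullet> \<xi>)) * h x z" for x z
  have [measurable]: "case_prod k \<in> borel_measurable (lborel \<Otimes>\<^sub>M lborel)"
    unfolding k_def h_def by measurable
  have "integrable (lborel \<Otimes>\<^sub>M lborel) (case_prod k)"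
    by (rule Bochner_Integration.integrable_bound[OF int])
      (auto simp: k_def norm_mult h_def)
  from lborel_pair.Fubini_integral[OF this]
  have "(LINT z|lborel. LINT x|lborel. k x z) = (LINT x|lborel. LINT z|lborel. k x z)" .
  moreover have "(LINT z|lborel. LINT x|lborel. k x z) = fourier (autocorrelation f) \<xi>"
    unfolding k_def h_def fourier_def autocorrelation_def integral_mult_right_zero
    by (simp add: mult.commute)
  moreover have "(LINT z|lborel. k x z) = cnj (exp (- \<i> * complex_of_real (x \<bullet> \<xi>)) * f x) * fourier f \<xi>" for x
  proof -
    have "k x z = cnj (exp (- \<i> * complex_of_real (x \<bullet> \<xi>)) * f x)
        * (exp (- \<i> * complex_of_real ((x + z) \<bullet> \<xi>)) * f (x + z))" for z
      by (simp add: k_def h_def exp_cnj algebra_simps exp_add[symmetric] flip: exp_add)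
    then show ?thesis
      by (simp only: integral_mult_right_zero fourier_def
          ti[of "\<lambda>z. exp (- \<i> * complex_of_real (z \<bullet> \<xi>)) * f z"])
  qed
  moreover have "(LINT x|lborel. cnj (exp (- \<i> * complex_of_real (x \<bullet> \<xi>)) * f x)) = cnj (fourier f \<xi>)"
    unfolding fourier_def by (rule Bochner_Integration.integral_cnj)
  ultimately have "fourier (autocorrelation f) \<xi> = cnj (fourier f \<xi>) * fourier f \<xi>"
    by (simp only: integral_mult_left_zero)
  then show "fourier (autocorrelation f) \<xi> = complex_of_real ((norm (fourier f \<xi>))\<^sup>2)"
    unfolding complex_norm_square by (simp only: mult.commute)
qed

text \<open>
  Polarization: \<open>|a - b|\<^sup>2 = |a|\<^sup>2 + |b|\<^sup>2 - 2 Re (a * cnj b)\<close>.  It turns continuity of translations in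
  \<open>L\<^sup>2\<close> into continuity at \<open>0\<close> of the real part of the autocorrelation, whose value there is the
  squared norm.
\<close>

lemma
  fixes f :: "real ^ 'n \<Rightarrow> complex"
  assumes f: "f \<in> borel_measurable borel" and f2: "integrable lborel (\<lambda>x. (norm (f x))\<^sup>2)"
  shows Re_autocorrelation: "Re (autocorrelation f z)
      = (LINT x|lborel. (norm (f x))\<^sup>2) - (LINT x|lborel. (norm (f (x + z) - f x))\<^sup>2) / 2"
    and abs_Re_autocorrelation_le: "\<bar>Re (autocorrelation f z)\<bar> \<le> (LINT x|lborel. (norm (f x))\<^sup>2)"
proof -
  note [measurable] = f
  let ?E = "LINT x|lborel. (norm (f x))\<^sup>2"
  have f2': "integrable lborel (\<lambda>x. (norm (f (x + z)))\<^sup>2)"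
    using lborel_integrable_translate[OF f2] .
  have E': "(LINT x|lborel. (norm (f (x + z)))\<^sup>2) = ?E"
    using lborel_integral_translate[of "\<lambda>x. (norm (f x))\<^sup>2" z] .
  have sum: "integrable lborel (\<lambda>x. (norm (f (x + z)))\<^sup>2 + (norm (f x))\<^sup>2)"
    using f2 f2' by simp
  have ab: "2 * (norm a * norm b) \<le> (norm a)\<^sup>2 + (norm b)\<^sup>2" for a b :: complex
    using zero_le_power2[of "norm a - norm b"] by (simp add: power2_eq_square algebra_simps)
  have int: "integrable lborel (\<lambda>x. f (x + z) * cnj (f x))"
  proof (rule Bochner_Integration.integrable_bound[OF sum])
    show "AE x in lborel. norm (f (x + z) * cnj (f x)) \<le> norm ((norm (f (x + z)))\<^sup>2 + (norm (f x))\<^sup>2)"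
    proof (rule AE_I2)
      fix x
      have "0 \<le> norm (f (x + z)) * norm (f x)" by simp
      with ab[of "f (x + z)" "f x"]
      have "norm (f (x + z)) * norm (f x) \<le> (norm (f (x + z)))\<^sup>2 + (norm (f x))\<^sup>2" by linarith
      then show "norm (f (x + z) * cnj (f x)) \<le> norm ((norm (f (x + z)))\<^sup>2 + (norm (f x))\<^sup>2)"
        by (simp add: norm_mult)
    qed
  qed simp
  have Re: "Re (autocorrelation f z) = (LINT x|lborel. Re (f (x + z) * cnj (f x)))"
    unfolding autocorrelation_def using int by (rule integral_Re[symmetric])
  have intRe: "integrable lborel (\<lambda>x. Re (f (x + z) * cnj (f x)))" using int by (rule integrable_Re)
  have "(LINT x|lborel. (norm (f (x + z) - f x))\<^sup>2)
      = (LINT x|lborel. ((norm (f (x + z)))\<^sup>2 + (norm (f x))\<^sup>2) - 2 * Re (f (x + z) * cnj (f x)))"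
    by (intro Bochner_Integration.integral_cong)
      (unfold cmod_power2, auto simp: power2_eq_square algebra_simps)
  also have "\<dots> = (?E + ?E) - 2 * Re (autocorrelation f z)"
    unfolding Re using intRe f2 f2' by (simp add: E' del: times_complex.sel)
  finally show "Re (autocorrelation f z) = ?E - (LINT x|lborel. (norm (f (x + z) - f x))\<^sup>2) / 2"
    by (simp add: field_simps)
  have "\<bar>Re (autocorrelation f z)\<bar> \<le> (LINT x|lborel. \<bar>Re (f (x + z) * cnj (f x))\<bar>)"
    unfolding Re by (rule integral_abs_bound)
  also have "\<dots> \<le> (LINT x|lborel. ((norm (f (x + z)))\<^sup>2 + (norm (f x))\<^sup>2) / 2)"
  proof (rule integral_mono)
    show "\<bar>Re (f (x + z) * cnj (f x))\<bar> \<le> ((norm (f (x + z)))\<^sup>2 + (norm (f x))\<^sup>2) / 2" for x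
      using abs_Re_le_cmod[of "f (x + z) * cnj (f x)"] ab[of "f (x + z)" "f x"]
      by (simp add: norm_mult)
  qed (use intRe sum in auto)
  also have "\<dots> = ?E" using f2 f2' E' by simp
  finally show "\<bar>Re (autocorrelation f z)\<bar> \<le> ?E" .
qed

text \<open>
  The multiplication formula for the autocorrelation and a dilated Gaussian.  The dilation is
  undone in the integral over \<open>y\<close>, so that the limit \<open>c \<rightarrow> 0\<close> can be taken under both integral
  signs: monotonically on the left, and by domination on the right.
\<close>

lemma
  fixes f :: "real ^ 'n \<Rightarrow> complex"
  assumes f: "integrable lborel f" and c: "c > 0"
  shows integrable_norm_fourier_gaussian:
      "integrable lborel (\<lambda>\<xi>. (norm (fourier f \<xi>))\<^sup>2 * exp (- (norm (c *\<^sub>R \<xi>))\<^sup>2 / 2))"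
    and integral_norm_fourier_gaussian:
      "(LINT \<xi>|lborel. (norm (fourier f \<xi>))\<^sup>2 * exp (- (norm (c *\<^sub>R \<xi>))\<^sup>2 / 2))
        = sqrt (2 * pi) ^ CARD('n) * (LINT y|lborel. Re (autocorrelation f (c *\<^sub>R y)) * exp (- (norm y)\<^sup>2 / 2))"
proof -
  have [measurable]: "f \<in> borel_measurable borel"
    using borel_measurable_integrable[OF f] by auto
  note [measurable] = borel_measurable_fourier
  define g where "g \<xi> = complex_of_real (exp (- (norm (c *\<^sub>R \<xi>))\<^sup>2 / 2))" for \<xi> :: "real ^ 'n"
  have gi: "integrable lborel (\<lambda>\<xi>::real ^ 'n. exp (- (norm (c *\<^sub>R \<xi>))\<^sup>2 / 2))"
    using lborel_integrable_affine[OF _ integrable_gaussian, of c 0] c by auto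
  then have g: "integrable lborel g" unfolding g_def by (rule integrable_of_real)
  let ?a = "autocorrelation f"
  note ai = integrable_autocorrelation[OF f]
  note fa = fourier_autocorrelation[OF f]
  have bd: "(norm (fourier f \<xi>))\<^sup>2 \<le> (LINT x|lborel. norm (f x))\<^sup>2" for \<xi>
    by (intro power_mono norm_fourier_le) simp
  show int: "integrable lborel (\<lambda>\<xi>. (norm (fourier f \<xi>))\<^sup>2 * exp (- (norm (c *\<^sub>R \<xi>))\<^sup>2 / 2))"
    by (rule Bochner_Integration.integrable_bound[OF integrable_mult_right[OF gi, of "(LINT x|lborel. norm (f x))\<^sup>2"]])
      (use bd in \<open>auto simp: intro!: mult_right_mono\<close>)
  have fg: "fourier g z = complex_of_real ((1 / c) ^ CARD('n) * (sqrt (2 * pi) ^ CARD('n) * exp (- (norm ((1 / c) *\<^sub>R z))\<^sup>2 / 2)))" for z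
  proof -
    have "fourier g z = (1 / c) ^ CARD('n) *\<^sub>R (LINT x|lborel. exp (- \<i> * complex_of_real (((1 / c) *\<^sub>R x) \<bullet> z)) * g ((1 / c) *\<^sub>R x))"
      unfolding fourier_def using c
      by (subst lborel_integral_affine[of "1 / c" _ 0]) auto
    also have "(LINT x|lborel. exp (- \<i> * complex_of_real (((1 / c) *\<^sub>R x) \<bullet> z)) * g ((1 / c) *\<^sub>R x))
        = (LINT x|lborel. exp (- \<i> * complex_of_real (x \<bullet> ((1 / c) *\<^sub>R z))) * complex_of_real (exp (- (norm x)\<^sup>2 / 2)))"
      using c by (simp add: g_def)
    also have "\<dots> = complex_of_real (sqrt (2 * pi) ^ CARD('n) * exp (- (norm ((1 / c) *\<^sub>R z))\<^sup>2 / 2))"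
      by (subst fourier_transform_gaussian) simp
    finally show ?thesis by (simp add: scaleR_conv_of_real)
  qed
  have "complex_of_real (LINT \<xi>|lborel. (norm (fourier f \<xi>))\<^sup>2 * exp (- (norm (c *\<^sub>R \<xi>))\<^sup>2 / 2))
      = (LINT \<xi>|lborel. fourier ?a \<xi> * g \<xi>)"
    unfolding fa g_def by (simp flip: integral_complex_of_real of_real_exp of_real_mult of_real_power)
  also have "\<dots> = (LINT z|lborel. ?a z * fourier g z)"
    by (rule fourier_multiplication[OF ai g])
  also have "\<dots> = c ^ CARD('n) *\<^sub>R (LINT y|lborel. ?a (c *\<^sub>R y) * fourier g (c *\<^sub>R y))"
    using c by (subst lborel_integral_affine[of c _ 0]) auto
  also have "(\<lambda>y. ?a (c *\<^sub>R y) * fourier g (c *\<^sub>R y))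
      = (\<lambda>y. complex_of_real ((1 / c) ^ CARD('n) * sqrt (2 * pi) ^ CARD('n)) *
            (?a (c *\<^sub>R y) * complex_of_real (exp (- (norm y)\<^sup>2 / 2))))"
    using c by (simp add: fg fun_eq_iff)
  also have "c ^ CARD('n) *\<^sub>R (LINT y|lborel. complex_of_real ((1 / c) ^ CARD('n) * sqrt (2 * pi) ^ CARD('n)) *
            (?a (c *\<^sub>R y) * complex_of_real (exp (- (norm y)\<^sup>2 / 2))))
      = complex_of_real (sqrt (2 * pi) ^ CARD('n)) * (LINT y|lborel. ?a (c *\<^sub>R y) * complex_of_real (exp (- (norm y)\<^sup>2 / 2)))"
    unfolding integral_mult_right_zero using c by (simp add: scaleR_conv_of_real power_one_over)
  finally have *: "complex_of_real (LINT \<xi>|lborel. (norm (fourier f \<xi>))\<^sup>2 * exp (- (norm (c *\<^sub>R \<xi>))\<^sup>2 / 2))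
      = complex_of_real (sqrt (2 * pi) ^ CARD('n)) * (LINT y|lborel. ?a (c *\<^sub>R y) * complex_of_real (exp (- (norm y)\<^sup>2 / 2)))" .
  have ac: "integrable lborel (\<lambda>y. ?a (c *\<^sub>R y))"
    using lborel_integrable_affine[OF _ ai, of c 0] c by auto
  then have [measurable]: "(\<lambda>y. ?a (c *\<^sub>R y)) \<in> borel_measurable borel" by auto
  have "integrable lborel (\<lambda>y. ?a (c *\<^sub>R y) * complex_of_real (exp (- (norm y)\<^sup>2 / 2)))"
    by (rule Bochner_Integration.integrable_bound[OF ac])
      (auto simp: norm_mult mult_left_le)
  from integral_Re[OF this] arg_cong[OF *, of Re]
  show "(LINT \<xi>|lborel. (norm (fourier f \<xi>))\<^sup>2 * exp (- (norm (c *\<^sub>R \<xi>))\<^sup>2 / 2))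
        = sqrt (2 * pi) ^ CARD('n) * (LINT y|lborel. Re (?a (c *\<^sub>R y)) * exp (- (norm y)\<^sup>2 / 2))"
    by (simp flip: of_real_exp)
qed

text \<open>
  Gaussian regularization with \<open>c = 1 / (m + 1)\<close>.  The right-hand side of the regularized
  identity tends to \<open>sqrt (2 * pi) ^ n\<close> times the squared norm times the mass \<open>sqrt (2 * pi) ^ n\<close>
  of the Gaussian; monotone convergence on the left gives integrability together with the value.
\<close>

lemma
  fixes f :: "real ^ 'n \<Rightarrow> complex"
  assumes f: "integrable lborel f" and f2: "integrable lborel (\<lambda>x. (norm (f x))\<^sup>2)"
  shows integrable_norm_fourier_square: "integrable lborel (\<lambda>\<xi>. (norm (fourier f \<xi>))\<^sup>2)"
    and plancherel_L1_L2:
      "(LINT \<xi>|lborel. (norm (fourier f \<xi>))\<^sup>2) = (2 * pi) ^ CARD('n) * (LINT x|lborel. (norm (f x))\<^sup>2)"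
proof -
  have fm[measurable]: "f \<in> borel_measurable borel"
    using borel_measurable_integrable[OF f] by auto
  note [measurable] = borel_measurable_fourier
  let ?a = "autocorrelation f" and ?E = "LINT x|lborel. (norm (f x))\<^sup>2"
  let ?G = "\<lambda>y::real ^ 'n. exp (- (norm y)\<^sup>2 / 2)"
  define c :: "nat \<Rightarrow> real" where "c m = 1 / real (Suc m)" for m
  have c: "c m > 0" for m by (simp add: c_def)
  have c0: "c \<longlonglongrightarrow> 0" unfolding c_def by (rule LIMSEQ_Suc[OF lim_1_over_n])
  have [measurable]: "?a \<in> borel_measurable borel"
    using borel_measurable_integrable[OF integrable_autocorrelation[OF f]] by simp
  have lim: "(\<lambda>m. LINT y|lborel. Re (?a (c m *\<^sub>R y)) * ?G y) \<longlonglongrightarrow> (LINT y|lborel. ?E * ?G y)"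
  proof (rule integral_dominated_convergence[where w="\<lambda>y. ?E * ?G y"])
    show "AE y in lborel. (\<lambda>m. Re (?a (c m *\<^sub>R y)) * ?G y) \<longlonglongrightarrow> ?E * ?G y"
    proof (rule AE_I2)
      fix y :: "real ^ 'n"
      have "(\<lambda>m. c m *\<^sub>R y) \<longlonglongrightarrow> 0 *\<^sub>R y" by (intro tendsto_intros c0)
      then have "(\<lambda>m. LINT x|lborel. (norm (f (x + c m *\<^sub>R y) - f x))\<^sup>2) \<longlonglongrightarrow> 0"
        by (intro L2_translation_tendsto f f2) simp
      then have "(\<lambda>m. ?E - (LINT x|lborel. (norm (f (x + c m *\<^sub>R y) - f x))\<^sup>2) / 2) \<longlonglongrightarrow> ?E - 0 / 2"
        by (intro tendsto_intros) auto
      then show "(\<lambda>m. Re (?a (c m *\<^sub>R y)) * ?G y) \<longlonglongrightarrow> ?E * ?G y"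
        unfolding Re_autocorrelation[OF fm f2] by (intro tendsto_intros) simp
    qed
    show "AE y in lborel. norm (Re (?a (c m *\<^sub>R y)) * ?G y) \<le> ?E * ?G y" for m
      using abs_Re_autocorrelation_le[OF fm f2] by (intro AE_I2) (simp add: abs_mult mult_right_mono)
    show "integrable lborel (\<lambda>y. ?E * ?G y)" by (intro integrable_mult_right integrable_gaussian)
  qed measurable
  have "complex_of_real (LINT y|lborel. ?G y) = complex_of_real (sqrt (2 * pi) ^ CARD('n))"
    using fourier_transform_gaussian[of "0 :: real ^ 'n"]
    by (simp del: of_real_power flip: of_real_exp of_real_power)
  then have G: "(LINT y|lborel. ?G y) = sqrt (2 * pi) ^ CARD('n)"
    by (simp only: of_real_eq_iff)
  have lim': "(\<lambda>m. LINT \<xi>|lborel. (norm (fourier f \<xi>))\<^sup>2 * ?G (c m *\<^sub>R \<xi>))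
      \<longlonglongrightarrow> sqrt (2 * pi) ^ CARD('n) * (?E * sqrt (2 * pi) ^ CARD('n))"
    unfolding integral_norm_fourier_gaussian[OF f c]
    using tendsto_mult_left[OF lim, of "sqrt (2 * pi) ^ CARD('n)"]
    unfolding integral_mult_right_zero G .
  have sq: "sqrt (2 * pi) ^ CARD('n) * (?E * sqrt (2 * pi) ^ CARD('n)) = (2 * pi) ^ CARD('n) * ?E"
  proof -
    have "sqrt (2 * pi) ^ CARD('n) * sqrt (2 * pi) ^ CARD('n) = (2 * pi) ^ CARD('n)"
      by (subst power_mult_distrib[symmetric]) simp
    then show ?thesis by (simp only: mult.left_commute[of _ ?E] mult.commute[of _ ?E])
  qed
  have mono: "mono (\<lambda>m. (norm (fourier f \<xi>))\<^sup>2 * ?G (c m *\<^sub>R \<xi>))" for \<xi>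
  proof (rule incseq_SucI)
    fix m
    have "norm (c (Suc m) *\<^sub>R \<xi>) \<le> norm (c m *\<^sub>R \<xi>)"
      by (simp add: c_def mult_right_mono frac_le)
    then have "(norm (c (Suc m) *\<^sub>R \<xi>))\<^sup>2 \<le> (norm (c m *\<^sub>R \<xi>))\<^sup>2" by (intro power_mono) auto
    then show "(norm (fourier f \<xi>))\<^sup>2 * ?G (c m *\<^sub>R \<xi>) \<le> (norm (fourier f \<xi>))\<^sup>2 * ?G (c (Suc m) *\<^sub>R \<xi>)"
      by (intro mult_left_mono) auto
  qed
  have pt: "(\<lambda>m. (norm (fourier f \<xi>))\<^sup>2 * ?G (c m *\<^sub>R \<xi>)) \<longlonglongrightarrow> (norm (fourier f \<xi>))\<^sup>2" for \<xi>
  proof -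
    have "(\<lambda>m. (norm (fourier f \<xi>))\<^sup>2 * ?G (c m *\<^sub>R \<xi>)) \<longlonglongrightarrow> (norm (fourier f \<xi>))\<^sup>2 * ?G (0 *\<^sub>R \<xi>)"
      by (intro tendsto_intros c0) simp
    then show ?thesis by simp
  qed
  note mc = integrable_norm_fourier_gaussian[OF f c] AE_I2[OF mono] AE_I2[OF pt] lim'[unfolded sq]
  show "integrable lborel (\<lambda>\<xi>. (norm (fourier f \<xi>))\<^sup>2)"
    by (rule integrable_monotone_convergence[OF mc]) auto
  show "(LINT \<xi>|lborel. (norm (fourier f \<xi>))\<^sup>2) = (2 * pi) ^ CARD('n) * ?E"
    by (rule integral_monotone_convergence[OF mc]) auto
qed

section \<open>The Fourier transform on square-integrable functions\<close>

lemma Lspace_2_iff: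
  "f \<in> Lspace 2 \<longleftrightarrow> f \<in> borel_measurable borel \<and> integrable lborel (\<lambda>x. (norm (f x))\<^sup>2)"
  by (simp add: Lspace_def)

lemma Lnorm_2_eq: "Lnorm 2 f = sqrt (LINT x|lborel. (norm (f x))\<^sup>2)"
  by (simp add: Lnorm_def powr_half_sqrt)

lemma Lspace_1_iff: "f \<in> Lspace 1 \<longleftrightarrow> integrable lborel f"
  by (auto simp: Lspace_def integrable_norm_iff dest: borel_measurable_integrable)

lemma Lnorm_1_eq: "Lnorm 1 f = (LINT x|lborel. norm (f x))"
  by (simp add: Lnorm_def)

text \<open>
  A replacement for the triangle inequality in \<open>L\<^sup>2\<close> that needs pointwise estimates only:
  \<open>||a|\<^sup>2 - |b|\<^sup>2| \<le> (1 + 1/d) |a - b|\<^sup>2 + d |b|\<^sup>2\<close> for every \<open>d > 0\<close>.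
\<close>

lemma L2_norm_tendsto:
  fixes F :: "nat \<Rightarrow> 'a::euclidean_space \<Rightarrow> complex"
  assumes F: "\<And>k. F k \<in> borel_measurable borel" "\<And>k. integrable lborel (\<lambda>x. (norm (F k x))\<^sup>2)"
    and g: "g \<in> borel_measurable borel" "integrable lborel (\<lambda>x. (norm (g x))\<^sup>2)"
    and lim: "(\<lambda>k. LINT x|lborel. (norm (F k x - g x))\<^sup>2) \<longlonglongrightarrow> 0"
  shows "(\<lambda>k. LINT x|lborel. (norm (F k x))\<^sup>2) \<longlonglongrightarrow> (LINT x|lborel. (norm (g x))\<^sup>2)"
proof -
  note [measurable] = F(1) g(1)
  let ?G = "LINT x|lborel. (norm (g x))\<^sup>2"
  have G: "?G \<ge> 0" by simp
  have D: "integrable lborel (\<lambda>x. (norm (F k x - g x))\<^sup>2)" for k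
  proof (rule Bochner_Integration.integrable_bound)
    show "integrable lborel (\<lambda>x. 2 * (norm (F k x))\<^sup>2 + 2 * (norm (g x))\<^sup>2)"
      using F(2)[of k] g(2) by auto
    show "AE x in lborel. norm ((norm (F k x - g x))\<^sup>2) \<le> norm (2 * (norm (F k x))\<^sup>2 + 2 * (norm (g x))\<^sup>2)"
      using norm_add_square_le[of "F k _" "- g _"] by (intro AE_I2) simp
  qed simp
  have "(\<lambda>k. \<bar>(LINT x|lborel. (norm (F k x))\<^sup>2) - ?G\<bar>) \<longlonglongrightarrow> 0"
  proof (rule LIMSEQ_0_up_to_epsilon)
    fix e :: real assume e: "e > 0"
    \<comment> \<open>the summand \<open>1\<close> keeps the denominator positive when \<open>g\<close> vanishes\<close>
    define d where "d = e / (?G + 1)"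
    have d: "d > 0" using e G by (simp add: d_def add_nonneg_pos)
    have dG: "d * ?G \<le> e"
    proof -
      have "?G + 1 \<noteq> 0" using G by linarith
      then have "e = d * (?G + 1)" by (simp add: d_def)
      with d show ?thesis by (simp add: algebra_simps)
    qed
    have pt: "\<bar>(norm a)\<^sup>2 - (norm b)\<^sup>2\<bar> \<le> (1 + 1 / d) * (norm (a - b))\<^sup>2 + d * (norm b)\<^sup>2"
      for a b :: complex
    proof -
      let ?s = "norm (a - b)"
      have "\<bar>norm a - norm b\<bar> \<le> ?s" by (rule norm_triangle_ineq3)
      then have "\<bar>norm a - norm b\<bar> * \<bar>norm a + norm b\<bar> \<le> ?s * (?s + 2 * norm b)"
        by (intro mult_mono) auto
      then have "\<bar>(norm a)\<^sup>2 - (norm b)\<^sup>2\<bar> \<le> ?s * (?s + 2 * norm b)"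
        by (simp add: power2_eq_square square_diff_square_factored abs_mult mult.commute)
      also have "\<dots> = ?s\<^sup>2 + 2 * (?s / sqrt d) * (sqrt d * norm b)"
        using d by (simp add: power2_eq_square algebra_simps)
      also have "2 * (?s / sqrt d) * (sqrt d * norm b) \<le> (?s / sqrt d)\<^sup>2 + (sqrt d * norm b)\<^sup>2"
        by (rule sum_squares_bound)
      finally show ?thesis using d by (simp add: power_divide algebra_simps)
    qed
    have "\<bar>(LINT x|lborel. (norm (F k x))\<^sup>2) - ?G\<bar>
        \<le> (1 + 1 / d) * (LINT x|lborel. (norm (F k x - g x))\<^sup>2) + e" for k
    proof -
      have "\<bar>(LINT x|lborel. (norm (F k x))\<^sup>2) - ?G\<bar> = \<bar>LINT x|lborel. (norm (F k x))\<^sup>2 - (norm (g x))\<^sup>2\<bar>"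
        using F(2)[of k] g(2) by simp
      also have "\<dots> \<le> (LINT x|lborel. \<bar>(norm (F k x))\<^sup>2 - (norm (g x))\<^sup>2\<bar>)"
        by (rule integral_abs_bound)
      also have "\<dots> \<le> (LINT x|lborel. (1 + 1 / d) * (norm (F k x - g x))\<^sup>2 + d * (norm (g x))\<^sup>2)"
        using F(2)[of k] g(2) D[of k]
        by (intro integral_mono pt Bochner_Integration.integrable_add integrable_mult_right
            integrable_abs Bochner_Integration.integrable_diff)
      also have "\<dots> = (1 + 1 / d) * (LINT x|lborel. (norm (F k x - g x))\<^sup>2) + d * ?G"
        using D[of k] g(2) by simp
      finally show ?thesis using dG by simp
    qed
    moreover have "(\<lambda>k. (1 + 1 / d) * (LINT x|lborel. (norm (F k x - g x))\<^sup>2)) \<longlonglongrightarrow> 0"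
      by (intro tendsto_mult_right_zero lim)
    ultimately show "\<exists>b. b \<longlonglongrightarrow> 0 \<and> (\<forall>k. \<bar>(LINT x|lborel. (norm (F k x))\<^sup>2) - ?G\<bar> \<le> b k + e)"
      by blast
  qed simp
  then show ?thesis using tendsto_rabs_zero_iff LIM_zero_iff by blast
qed

text \<open>
  Truncations to balls are in \<open>L\<^sup>1 \<inter> L\<^sup>2\<close>, because \<open>|y| \<le> 1 + |y|\<^sup>2\<close> and balls have finite measure.
  This is what makes the identity for \<open>L\<^sup>1 \<inter> L\<^sup>2\<close> applicable to the approximants of the transform on
  \<open>L\<^sup>2\<close>.
\<close>

lemma
  fixes f :: "real ^ 'n \<Rightarrow> complex"
  assumes f: "f \<in> Lspace 2"
  shows integrable_ball_truncation: "integrable lborel (\<lambda>x. indicator (ball 0 R) x * f x)"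
    and integrable_ball_truncation_square:
      "integrable lborel (\<lambda>x. (norm (indicator (ball 0 R) x * f x))\<^sup>2)"
proof -
  from f have fm [measurable]: "f \<in> borel_measurable borel"
    and f2: "integrable lborel (\<lambda>x. (norm (f x))\<^sup>2)" by (auto simp: Lspace_2_iff)
  have "(indicator (ball 0 R) :: real ^ 'n \<Rightarrow> complex) \<in> borel_measurable borel"
    by (intro borel_measurable_indicator) simp
  then have [measurable]: "(\<lambda>x. indicator (ball 0 R) x * f x) \<in> borel_measurable borel"
    using fm by (rule borel_measurable_times)
  show "integrable lborel (\<lambda>x. (norm (indicator (ball 0 R) x * f x))\<^sup>2)"
    by (rule Bochner_Integration.integrable_bound[OF f2]) (auto simp: indicator_def)
  have b: "integrable lborel (indicator (ball 0 R) :: real ^ 'n \<Rightarrow> real)"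
    by (intro integrable_real_indicator emeasure_lborel_ball_finite) simp
  show "integrable lborel (\<lambda>x. indicator (ball 0 R) x * f x)"
  proof (rule Bochner_Integration.integrable_bound)
    show "integrable lborel (\<lambda>x. indicator (ball 0 R) x + (norm (f x))\<^sup>2)"
      using b f2 by (rule Bochner_Integration.integrable_add)
    have "norm y \<le> 1 + (norm y)\<^sup>2" for y :: complex
    proof -
      have "2 * norm y * 1 \<le> (norm y)\<^sup>2 + 1\<^sup>2" by (rule sum_squares_bound)
      moreover have "0 \<le> (norm y)\<^sup>2" by simp
      ultimately show ?thesis by (simp only: power_one mult_1_right)
    qed
    then show "AE x in lborel. norm (indicator (ball 0 R) x * f x) \<le> norm (indicator (ball 0 R) x + (norm (f x))\<^sup>2)"
      by (intro AE_I2) (auto simp: indicator_def)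
  qed simp
qed

lemma has_L2_fourier_sequence:
  assumes "has_L2_fourier f g"
  shows "(\<lambda>k. LINT \<xi>|lborel. (norm (fourier (\<lambda>x. indicator (ball 0 (real k)) x * f x) \<xi> - g \<xi>))\<^sup>2) \<longlonglongrightarrow> 0"
proof -
  have "((\<lambda>R. Lnorm 2 (\<lambda>\<xi>. fourier (\<lambda>x. indicator (ball 0 R) x * f x) \<xi> - g \<xi>)) \<longlongrightarrow> 0) at_top"
    using assms by (simp add: has_L2_fourier_def)
  from filterlim_compose[OF this filterlim_real_sequentially]
  have "(\<lambda>k. Lnorm 2 (\<lambda>\<xi>. fourier (\<lambda>x. indicator (ball 0 (real k)) x * f x) \<xi> - g \<xi>)) \<longlonglongrightarrow> 0" .
  from tendsto_power[OF this, of 2] show ?thesis by (simp add: Lnorm_2_eq)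
qed

lemma eventually_mem_ball_nat: "eventually (\<lambda>k::nat. x \<in> ball 0 (real k)) sequentially"
  for x :: "'a::real_normed_vector"
proof -
  obtain m :: nat where "norm x < real m" using reals_Archimedean2 by blast
  then show ?thesis
    by (intro eventually_mono[OF eventually_ge_at_top[of m]]) auto
qed

text \<open>
  Apply the identity for \<open>L\<^sup>1 \<inter> L\<^sup>2\<close> to the truncations of \<open>f\<close>; the squared norms converge on both
  sides.
\<close>

theorem plancherel:
  fixes f g :: "real ^ 'n \<Rightarrow> complex"
  assumes fg: "has_L2_fourier f g"
  shows "(LINT \<xi>|lborel. (norm (g \<xi>))\<^sup>2) = (2 * pi) ^ CARD('n) * (LINT x|lborel. (norm (f x))\<^sup>2)"
proof -
  from fg have f: "f \<in> Lspace 2" and g: "g \<in> Lspace 2" by (auto simp: has_L2_fourier_def)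
  from f have [measurable]: "f \<in> borel_measurable borel"
    and f2: "integrable lborel (\<lambda>x. (norm (f x))\<^sup>2)" by (auto simp: Lspace_2_iff)
  let ?t = "\<lambda>k x. indicator (ball 0 (real k)) x * f x"
  note t = integrable_ball_truncation[OF f] integrable_ball_truncation_square[OF f]
  have [measurable]: "?t k \<in> borel_measurable borel" for k
    using borel_measurable_integrable[OF t(1)] by simp
  then have [measurable]: "fourier (?t k) \<in> borel_measurable borel" for k
    by (rule borel_measurable_fourier)
  have "(\<lambda>k. LINT \<xi>|lborel. (norm (fourier (?t k) \<xi>))\<^sup>2) \<longlonglongrightarrow> (LINT \<xi>|lborel. (norm (g \<xi>))\<^sup>2)"
    using g integrable_norm_fourier_square[OF t]
    by (intro L2_norm_tendsto has_L2_fourier_sequence[OF fg]) (auto simp: Lspace_2_iff)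
  moreover have "(\<lambda>k. LINT \<xi>|lborel. (norm (fourier (?t k) \<xi>))\<^sup>2)
      \<longlonglongrightarrow> (2 * pi) ^ CARD('n) * (LINT x|lborel. (norm (f x))\<^sup>2)"
    unfolding plancherel_L1_L2[OF t]
  proof (intro tendsto_mult_left L2_norm_tendsto t f2)
    have eq: "indicator (ball 0 R) x *\<^sub>R f x = indicator (ball 0 R) x * f x" for R x
      by (simp add: indicator_def)
    have "(\<lambda>k. LINT x|lborel. (norm (f x - indicator (ball 0 (real k)) x *\<^sub>R f x))\<^sup>2) \<longlonglongrightarrow> 0"
      by (intro L2_truncation_tendsto f2 eventually_mem_ball_nat) auto
    then show "(\<lambda>k. LINT x|lborel. (norm (?t k x - f x))\<^sup>2) \<longlonglongrightarrow> 0"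
      unfolding eq by (simp add: norm_minus_commute)
  qed auto
  ultimately show ?thesis by (rule LIMSEQ_unique)
qed

text \<open>
  For an integrable \<open>f\<close> the transforms of the truncations converge pointwise to \<open>fourier f\<close> and
  in \<open>L\<^sup>2\<close> to \<open>g\<close>.  By Fatou the two limits agree almost everywhere.
\<close>

lemma has_L2_fourier_AE_eq_fourier:
  fixes f g :: "real ^ 'n \<Rightarrow> complex"
  assumes fg: "has_L2_fourier f g" and f1: "integrable lborel f"
  shows "AE \<xi> in lborel. g \<xi> = fourier f \<xi>"
proof -
  from fg have f: "f \<in> Lspace 2" and g: "g \<in> Lspace 2" by (auto simp: has_L2_fourier_def)
  from f g have [measurable]: "f \<in> borel_measurable borel" "g \<in> borel_measurable borel"
    and g2: "integrable lborel (\<lambda>x. (norm (g x))\<^sup>2)" by (auto simp: Lspace_2_iff)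
  let ?t = "\<lambda>k x. indicator (ball 0 (real k)) x * f x"
  note t = integrable_ball_truncation[OF f] integrable_ball_truncation_square[OF f]
  have [measurable]: "?t k \<in> borel_measurable borel" for k
    using borel_measurable_integrable[OF t(1)] by simp
  then have [measurable]: "fourier (?t k) \<in> borel_measurable borel" for k
    by (rule borel_measurable_fourier)
  have [measurable]: "fourier f \<in> borel_measurable borel"
    by (rule borel_measurable_fourier) simp
  have pt: "(\<lambda>k. fourier (?t k) \<xi>) \<longlonglongrightarrow> fourier f \<xi>" for \<xi>
    unfolding fourier_def
  proof (rule integral_dominated_convergence[where w="\<lambda>x. norm (f x)"])
    show "AE x in lborel. (\<lambda>k. exp (- \<i> * complex_of_real (x \<bullet> \<xi>)) * ?t k x)
        \<longlonglongrightarrow> exp (- \<i> * complex_of_real (x \<bullet> \<xi>)) * f x"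
    proof (rule AE_I2)
      fix x
      have "eventually (\<lambda>k. exp (- \<i> * complex_of_real (x \<bullet> \<xi>)) * ?t k x
          = exp (- \<i> * complex_of_real (x \<bullet> \<xi>)) * f x) sequentially"
        using eventually_mem_ball_nat[of x] by eventually_elim simp
      then show "(\<lambda>k. exp (- \<i> * complex_of_real (x \<bullet> \<xi>)) * ?t k x)
        \<longlonglongrightarrow> exp (- \<i> * complex_of_real (x \<bullet> \<xi>)) * f x"
        by (rule tendsto_eventually)
    qed
  qed (use f1 in \<open>auto simp: norm_mult indicator_def\<close>)
  let ?D = "\<lambda>k \<xi>. (norm (fourier (?t k) \<xi> - g \<xi>))\<^sup>2"
  have D: "integrable lborel (?D k)" for k
  proof (rule Bochner_Integration.integrable_bound)
    show "integrable lborel (\<lambda>\<xi>. 2 * (norm (fourier (?t k) \<xi>))\<^sup>2 + 2 * (norm (g \<xi>))\<^sup>2)"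
      using integrable_norm_fourier_square[OF t, of "real k"] g2 by simp
    show "AE \<xi> in lborel. norm (?D k \<xi>) \<le> norm (2 * (norm (fourier (?t k) \<xi>))\<^sup>2 + 2 * (norm (g \<xi>))\<^sup>2)"
      using norm_add_square_le[of "fourier (?t k) _" "- g _"] by (intro AE_I2) simp
  qed simp
  have "(\<integral>\<^sup>+\<xi>. ennreal ((norm (fourier f \<xi> - g \<xi>))\<^sup>2) \<partial>lborel)
      = (\<integral>\<^sup>+\<xi>. liminf (\<lambda>k. ennreal (?D k \<xi>)) \<partial>lborel)"
    by (intro nn_integral_cong lim_imp_Liminf[symmetric] tendsto_ennrealI tendsto_intros pt) auto
  also have "\<dots> \<le> liminf (\<lambda>k. \<integral>\<^sup>+\<xi>. ennreal (?D k \<xi>) \<partial>lborel)"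
    by (rule nn_integral_liminf) simp
  also have "(\<lambda>k. \<integral>\<^sup>+\<xi>. ennreal (?D k \<xi>) \<partial>lborel) = (\<lambda>k. ennreal (LINT \<xi>|lborel. ?D k \<xi>))"
    by (intro ext nn_integral_eq_integral D) simp
  also have "liminf \<dots> = ennreal 0"
    by (intro lim_imp_Liminf tendsto_ennrealI has_L2_fourier_sequence[OF fg]) simp
  finally have "(\<integral>\<^sup>+\<xi>. ennreal ((norm (fourier f \<xi> - g \<xi>))\<^sup>2) \<partial>lborel) = 0" by simp
  then have "AE \<xi> in lborel. ennreal ((norm (fourier f \<xi> - g \<xi>))\<^sup>2) = 0"
    by (subst (asm) nn_integral_0_iff_AE) auto
  then show ?thesis by eventually_elim simp
qed

lemma has_L2_fourier_AE_eq_fourier_of_AE_eq: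
  fixes f g h :: "real ^ 'n \<Rightarrow> complex"
  assumes fg: "has_L2_fourier f g" and h: "integrable lborel h" and fh: "AE x in lborel. f x = h x"
  shows "AE \<xi> in lborel. g \<xi> = fourier h \<xi>"
proof -
  have m [measurable]: "f \<in> borel_measurable borel" "h \<in> borel_measurable borel"
    using fg h by (auto simp: has_L2_fourier_def Lspace_2_iff dest: borel_measurable_integrable)
  have "integrable lborel f"
    using h fh integrable_cong_AE[of f lborel h] by simp
  moreover have "fourier f = fourier h"
    unfolding fourier_def
    by (intro ext integral_cong_AE) (use fh in \<open>auto elim!: eventually_mono\<close>)
  ultimately show ?thesis using has_L2_fourier_AE_eq_fourier[OF fg] by simp
qed

section \<open>The damped oscillator at a fixed frequency\<close>

text \<open>
  With \<open>p = exp (a s) y\<close> and \<open>q = p'\<close> the equation becomes \<open>p'' = - \<omega>\<^sup>2 p\<close>.  Rotating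
  \<open>(p, q)\<close> back by the flow of this harmonic oscillator gives two quantities \<open>A\<close> and \<open>B\<close> with
  derivative zero, and \<open>p\<close> is recovered from their values at time \<open>0\<close>.
\<close>

lemma underdamped_oscillator_solution:
  fixes y y' :: "real \<Rightarrow> complex" and a \<omega> :: real
  assumes \<omega>: "\<omega> \<noteq> 0"
    and y: "\<And>t. t \<ge> 0 \<Longrightarrow> (y has_vector_derivative y' t) (at t within {0..})"
    and y': "\<And>t. t \<ge> 0 \<Longrightarrow> \<exists>y''. (y' has_vector_derivative y'') (at t within {0..}) \<and>
        y'' + 2 * of_real a * y' t + of_real (\<omega>\<^sup>2 + a\<^sup>2) * y t = 0"
    and t: "t \<ge> 0"
  shows "y t = exp (- a * t) *\<^sub>R (cos (\<omega> * t) *\<^sub>R y 0 + (sin (\<omega> * t) / \<omega>) *\<^sub>R (y' 0 + a *\<^sub>R y 0))"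
proof -
  define p where "p s = exp (a * s) *\<^sub>R y s" for s
  define q where "q s = exp (a * s) *\<^sub>R (y' s + a *\<^sub>R y s)" for s
  have p: "(p has_vector_derivative q s) (at s within {0..})" if "s \<ge> 0" for s
  proof -
    have "((\<lambda>s. exp (a * s)) has_real_derivative exp (a * s) * a) (at s within {0..})"
      by (auto intro!: derivative_eq_intros)
    from has_vector_derivative_scaleR[OF this y[OF that]] show ?thesis
      by (simp add: p_def[abs_def] q_def scaleR_add_right)
  qed
  have q: "(q has_vector_derivative - (\<omega>\<^sup>2 *\<^sub>R p s)) (at s within {0..})" if s: "s \<ge> 0" for s
  proof -
    obtain y'' where y'': "(y' has_vector_derivative y'') (at s within {0..})"
      and eq: "y'' + 2 * of_real a * y' s + of_real (\<omega>\<^sup>2 + a\<^sup>2) * y s = 0" using y'[OF s] by blast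
    have "exp (a * s) *\<^sub>R (y'' + a *\<^sub>R y' s) + (exp (a * s) * a) *\<^sub>R (y' s + a *\<^sub>R y s)
        = exp (a * s) *\<^sub>R (y'' + 2 * of_real a * y' s + of_real (\<omega>\<^sup>2 + a\<^sup>2) * y s) - \<omega>\<^sup>2 *\<^sub>R p s"
      by (simp add: p_def scaleR_conv_of_real algebra_simps power2_eq_square)
    then have "exp (a * s) *\<^sub>R (y'' + a *\<^sub>R y' s) + (exp (a * s) * a) *\<^sub>R (y' s + a *\<^sub>R y s) = - (\<omega>\<^sup>2 *\<^sub>R p s)"
      unfolding eq by simp
    moreover have "(q has_vector_derivative
        exp (a * s) *\<^sub>R (y'' + a *\<^sub>R y' s) + (exp (a * s) * a) *\<^sub>R (y' s + a *\<^sub>R y s)) (at s within {0..})"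
    proof -
      have e: "((\<lambda>s. exp (a * s)) has_real_derivative exp (a * s) * a) (at s within {0..})"
        by (auto intro!: derivative_eq_intros)
      have "((\<lambda>s. a *\<^sub>R y s) has_vector_derivative a *\<^sub>R y' s) (at s within {0..})"
        using bounded_linear.has_vector_derivative[OF bounded_linear_scaleR_right y[OF s]] .
      from has_vector_derivative_scaleR[OF e has_vector_derivative_add[OF y'' this]] show ?thesis
        by (simp add: q_def[abs_def])
    qed
    ultimately show ?thesis by simp
  qed
  define A where "A s = cos (\<omega> * s) *\<^sub>R p s - (sin (\<omega> * s) / \<omega>) *\<^sub>R q s" for s
  define B where "B s = (\<omega> * sin (\<omega> * s)) *\<^sub>R p s + cos (\<omega> * s) *\<^sub>R q s" for s
  have A': "(A has_vector_derivative 0) (at s within {0..})" if s: "s \<in> {0..}" for s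
  proof -
    have s0: "s \<ge> 0" using s by simp
    have "(A has_vector_derivative (cos (\<omega> * s) *\<^sub>R q s + (- (sin (\<omega> * s) * \<omega>)) *\<^sub>R p s)
        - ((sin (\<omega> * s) / \<omega>) *\<^sub>R (- (\<omega>\<^sup>2 *\<^sub>R p s)) + cos (\<omega> * s) *\<^sub>R q s)) (at s within {0..})"
      unfolding A_def using \<omega>
      by (intro has_vector_derivative_diff has_vector_derivative_scaleR p[OF s0] q[OF s0])
        (auto intro!: derivative_eq_intros)
    then show ?thesis using \<omega> by (simp add: power2_eq_square)
  qed
  have B': "(B has_vector_derivative 0) (at s within {0..})" if s: "s \<in> {0..}" for s
  proof -
    have s0: "s \<ge> 0" using s by simp
    have "(B has_vector_derivative ((\<omega> * sin (\<omega> * s)) *\<^sub>R q s + (\<omega> * (cos (\<omega> * s) * \<omega>)) *\<^sub>R p s)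
        + (cos (\<omega> * s) *\<^sub>R (- (\<omega>\<^sup>2 *\<^sub>R p s)) + (- (sin (\<omega> * s) * \<omega>)) *\<^sub>R q s)) (at s within {0..})"
      unfolding B_def
      by (intro has_vector_derivative_add has_vector_derivative_scaleR p[OF s0] q[OF s0])
        (auto intro!: derivative_eq_intros)
    then show ?thesis by (simp add: power2_eq_square mult_ac)
  qed
  have const: "h t = h 0" if z: "\<And>s. s \<in> {0..} \<Longrightarrow> (h has_vector_derivative 0) (at s within {0..})"
    for h :: "real \<Rightarrow> complex"
  proof -
    obtain c where "\<And>s. s \<in> {0..} \<Longrightarrow> h s = c"
      using has_vector_derivative_zero_constant[OF _ z] by (metis convex_real_interval(1))
    then show ?thesis using t by simp
  qed
  have A0: "A t = y 0" using const[OF A'] by (simp add: A_def p_def)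
  have B0: "B t = y' 0 + a *\<^sub>R y 0" using const[OF B'] by (simp add: B_def q_def)
  have "cos (\<omega> * t) *\<^sub>R A t + (sin (\<omega> * t) / \<omega>) *\<^sub>R B t
      = ((cos (\<omega> * t))\<^sup>2 + (sin (\<omega> * t))\<^sup>2) *\<^sub>R p t"
    using \<omega> unfolding A_def B_def
    by (simp add: scaleR_diff_right scaleR_add_right scaleR_add_left power2_eq_square mult_ac
        del: sin_cos_squared_add sin_cos_squared_add2 sin_cos_squared_add3)
  then have "p t = cos (\<omega> * t) *\<^sub>R y 0 + (sin (\<omega> * t) / \<omega>) *\<^sub>R (y' 0 + a *\<^sub>R y 0)"
    unfolding A0 B0 by simp
  moreover have "y t = exp (- a * t) *\<^sub>R p t"
    by (simp add: p_def flip: exp_add)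
  ultimately show ?thesis by simp
qed

lemma half_le_sin:
  fixes x :: real
  assumes "0 \<le> x" "x \<le> 1"
  shows "x / 2 \<le> sin x"
proof -
  have "(\<lambda>x. sin x - x / 2) 0 \<le> (\<lambda>x. sin x - x / 2) x"
  proof (rule DERIV_nonneg_imp_nondecreasing[OF assms(1)])
    fix s assume s: "0 \<le> s" "s \<le> x"
    have "s \<le> pi / 3" using s assms pi_gt3 by linarith
    then have "cos (pi / 3) \<le> cos s" using s pi_gt_zero by (intro cos_monotone_0_pi_le) auto
    then show "\<exists>y. ((\<lambda>x. sin x - x / 2) has_real_derivative y) (at s) \<and> 0 \<le> y"
      by (intro exI[of _ "cos s - 1 / 2"]) (auto intro!: derivative_eq_intros simp: cos_60)
  qed
  then show ?thesis by simp
qed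

lemma abs_sin_divide_le:
  fixes \<omega> t :: real
  assumes "\<omega> > 0" "t \<ge> 0"
  shows "\<bar>sin (\<omega> * t) / \<omega>\<bar> \<le> t"
  using abs_sin_x_le_abs_x[of "\<omega> * t"] assms by (simp add: abs_mult field_simps)

text \<open>
  The value at time \<open>t\<close> of the solution of \<open>y'' + 2 log (1 + r) y' + r\<^sup>2 y = 0\<close> with
  \<open>y 0 = a0\<close> and \<open>y' 0 = a1\<close>, in the form that is valid for \<open>r > 0\<close>.
\<close>

definition log_damped_solution :: "real \<Rightarrow> complex \<Rightarrow> complex \<Rightarrow> real \<Rightarrow> complex" where
  "log_damped_solution r a0 a1 t =
     (let a = ln (1 + r); \<omega> = sqrt (r\<^sup>2 - a\<^sup>2) in
      exp (- a * t) *\<^sub>R (cos (\<omega> * t) *\<^sub>R a0 + (sin (\<omega> * t) / \<omega>) *\<^sub>R (a1 + a *\<^sub>R a0)))"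

lemma log_damping_less_square:
  fixes r :: real
  assumes "r > 0"
  shows "(ln (1 + r))\<^sup>2 < r\<^sup>2"
proof -
  have "ln (1 + r) < r" using ln_add_one_self_less_self[OF assms] .
  then show ?thesis using assms by (intro power_strict_mono) auto
qed

text \<open>
  Only \<open>|sin (\<omega> t) / \<omega>| \<le> t\<close> and \<open>log (1 + r) \<le> r\<close> enter, so the estimate is uniform in the size of
  \<open>\<omega>\<close>, although \<open>\<omega>\<close> vanishes like \<open>r powr (3/2)\<close> at \<open>r = 0\<close>.
\<close>

lemma norm_log_damped_solution_le:
  assumes r: "r > 0" and t: "t \<ge> 0"
  shows "norm (log_damped_solution r a0 a1 t) \<le> (1 + r) powr (- t) * ((1 + r * t) * norm a0 + t * norm a1)"
proof -
  define a where "a = ln (1 + r)"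
  define \<omega> where "\<omega> = sqrt (r\<^sup>2 - a\<^sup>2)"
  have a: "0 \<le> a" "a \<le> r" using r ln_add_one_self_le_self[of r] by (auto simp: a_def)
  have \<omega>: "\<omega> > 0" using log_damping_less_square[OF r] by (simp add: \<omega>_def a_def)
  have e: "exp (- a * t) = (1 + r) powr (- t)" using r by (simp add: a_def powr_def mult.commute)
  note sb = abs_sin_divide_le[OF \<omega> t]
  have "norm (cos (\<omega> * t) *\<^sub>R a0 + (sin (\<omega> * t) / \<omega>) *\<^sub>R (a1 + a *\<^sub>R a0))
      \<le> \<bar>cos (\<omega> * t)\<bar> * norm a0 + \<bar>sin (\<omega> * t) / \<omega>\<bar> * norm (a1 + a *\<^sub>R a0)"
    by (rule order_trans[OF norm_triangle_ineq]) simp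
  also have "\<dots> \<le> 1 * norm a0 + t * (norm a1 + r * norm a0)"
  proof (intro add_mono mult_mono sb)
    show "norm (a1 + a *\<^sub>R a0) \<le> norm a1 + r * norm a0"
      by (rule order_trans[OF norm_triangle_ineq]) (use a in \<open>auto intro!: mult_right_mono\<close>)
  qed (use t in auto)
  finally show ?thesis
    unfolding log_damped_solution_def Let_def a_def[symmetric] \<omega>_def[symmetric] norm_scaleR e
    using r by (intro mult_mono) (auto simp: algebra_simps)
qed

text \<open>
  In the range \<open>r t \<le> 1\<close> neither the damping nor the oscillation is visible yet: the
  exponential is at least \<open>1 / e \<ge> 1 / 3\<close>, and \<open>\<omega> t \<le> 1\<close> gives \<open>sin (\<omega> t) / \<omega> \<ge> t / 2\<close>.
\<close>

lemma norm_log_damped_solution_ge: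
  assumes r: "r > 0" and t: "t \<ge> 0" and rt: "r * t \<le> 1"
  shows "norm (log_damped_solution r a0 a1 t) \<ge> t / 6 * norm a1 - 2 * norm a0"
proof -
  define a where "a = ln (1 + r)"
  define \<omega> where "\<omega> = sqrt (r\<^sup>2 - a\<^sup>2)"
  have a: "0 \<le> a" "a \<le> r" using r ln_add_one_self_le_self[of r] by (auto simp: a_def)
  have \<omega>: "\<omega> > 0" using log_damping_less_square[OF r] by (simp add: \<omega>_def a_def)
  have "\<omega> \<le> sqrt (r\<^sup>2)" unfolding \<omega>_def by (intro real_sqrt_le_mono) simp
  then have \<omega>r: "\<omega> \<le> r" using r by simp
  have at: "a * t \<le> 1" using mult_right_mono[OF a(2) t] rt by linarith
  have \<omega>t: "0 \<le> \<omega> * t" "\<omega> * t \<le> 1" using mult_right_mono[OF \<omega>r t] rt \<omega> t by auto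
  define S where "S = sin (\<omega> * t) / \<omega>"
  have S: "t / 2 \<le> S"
    using half_le_sin[OF \<omega>t] \<omega> by (simp add: S_def field_simps)
  have S': "S \<le> t" using abs_sin_divide_le[OF \<omega> t] unfolding S_def by (rule order_trans[OF abs_ge_self])
  have S0: "0 \<le> S" using S t by linarith
  have "exp (1::real) \<le> 3" using e_less_272 by simp
  then have "1 / 3 \<le> exp (- 1 :: real)" by (simp add: exp_minus field_simps)
  also have "\<dots> \<le> exp (- a * t)" using at by simp
  finally have e: "1 / 3 \<le> exp (- a * t)" .
  have e1: "exp (- a * t) \<le> 1" using a t by simp
  have "norm (cos (\<omega> * t) *\<^sub>R a0 + (S * a) *\<^sub>R a0) \<le> \<bar>cos (\<omega> * t)\<bar> * norm a0 + S * a * norm a0"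
    by (rule order_trans[OF norm_triangle_ineq]) (use a S0 in \<open>simp add: abs_mult\<close>)
  also have "\<dots> \<le> 1 * norm a0 + 1 * norm a0"
  proof (intro add_mono mult_right_mono)
    have "S * a \<le> t * a" using S' a by (intro mult_right_mono) auto
    then show "S * a \<le> 1" using at by (simp add: mult.commute)
  qed auto
  finally have z: "norm (cos (\<omega> * t) *\<^sub>R a0 + (S * a) *\<^sub>R a0) \<le> 2 * norm a0" by simp
  let ?z = "cos (\<omega> * t) *\<^sub>R a0 + (S * a) *\<^sub>R a0"
  have "t / 6 * norm a1 - 2 * norm a0 \<le> exp (- a * t) * (S * norm a1) - exp (- a * t) * norm ?z"
  proof (rule diff_mono)
    have "1 / 3 * (t / 2 * norm a1) \<le> exp (- a * t) * (S * norm a1)"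
      using e S t by (intro mult_mono mult_right_mono) auto
    then show "t / 6 * norm a1 \<le> exp (- a * t) * (S * norm a1)" by simp
    have "exp (- a * t) * norm ?z \<le> 1 * (2 * norm a0)" using z e1 by (intro mult_mono) auto
    then show "exp (- a * t) * norm ?z \<le> 2 * norm a0" by simp
  qed
  also have "\<dots> = exp (- a * t) * (norm (S *\<^sub>R a1) - norm ?z)"
    using S0 by (simp add: right_diff_distrib)
  also have "\<dots> \<le> exp (- a * t) * norm (S *\<^sub>R a1 + ?z)"
    by (intro mult_left_mono norm_diff_ineq) simp
  also have "\<dots> = norm (log_damped_solution r a0 a1 t)"
    unfolding log_damped_solution_def Let_def a_def[symmetric] \<omega>_def[symmetric] norm_scaleR S_def[symmetric]
    by (simp add: scaleR_add_right add_ac)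
  finally show ?thesis .
qed

section \<open>The solution in frequency space\<close>

lemma Bernoulli_inequality_powr:
  fixes p r :: real
  assumes p: "1 \<le> p" and r: "0 \<le> r"
  shows "1 + p * r \<le> (1 + r) powr p"
proof -
  have "(\<lambda>s. p * ln (1 + s) - ln (1 + p * s)) 0 \<le> (\<lambda>s. p * ln (1 + s) - ln (1 + p * s)) r"
  proof (rule DERIV_nonneg_imp_nondecreasing[OF r])
    fix s assume s: "0 \<le> s" "s \<le> r"
    have pos: "1 + s > 0" "1 + p * s > 0" using s p by (auto intro!: add_pos_nonneg)
    have "s \<le> p * s" using s p by (simp add: mult_le_cancel_right1)
    then have "p / (1 + p * s) \<le> p / (1 + s)" using p s pos by (intro divide_left_mono) auto
    then show "\<exists>y. ((\<lambda>s. p * ln (1 + s) - ln (1 + p * s)) has_real_derivative y) (at s) \<and> 0 \<le> y"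
      using pos
      by (intro exI[of _ "p / (1 + s) - p / (1 + p * s)"]) (auto intro!: derivative_eq_intros)
  qed
  then have "ln (1 + p * r) \<le> ln ((1 + r) powr p)" using r by simp
  moreover have "1 + p * r > 0" using p r by (intro add_pos_nonneg) auto
  ultimately show ?thesis using r by (subst (asm) ln_le_cancel_iff) auto
qed

text \<open>
  The multiplier \<open>(1 + r)\<^sup>-\<^sup>t\<close> decays in \<open>r t\<close> faster than any fixed power once \<open>t\<close> is large:
  with \<open>N = m + 1\<close>, Bernoulli gives
  \<open>(1 + r)\<^sup>t = ((1 + r) powr (t / N)) ^ N \<ge> (1 + r t / N) ^ N \<ge> ((1 + r t) / N) ^ N\<close>.  One estimate
  thus covers low and high frequencies at once.
\<close>

lemma powr_minus_le_inverse_power: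
  fixes r t :: real and m :: nat
  assumes r: "0 \<le> r" and t: "real (Suc m) \<le> t"
  shows "(1 + r) powr (- t) * (1 + r * t) \<le> real (Suc m) ^ Suc m / (1 + r * t) ^ m"
proof -
  let ?N = "real (Suc m)"
  have N: "?N > 0" "1 \<le> ?N" by simp_all
  have t0: "t > 0" using t N by linarith
  have q: "1 + r * t > 0" using r t0 by (intro add_pos_nonneg) auto
  have "(1 + r * t) / ?N \<le> 1 + (t / ?N) * r"
    using N by (simp add: field_simps)
  also have "\<dots> \<le> (1 + r) powr (t / ?N)"
    using t N by (intro Bernoulli_inequality_powr r) (simp add: field_simps)
  finally have "((1 + r * t) / ?N) ^ Suc m \<le> ((1 + r) powr (t / ?N)) ^ Suc m"
    using q by (intro power_mono) auto
  also have "\<dots> = (1 + r) powr t"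
    using r N by (subst powr_power) (auto simp del: of_nat_Suc)
  finally have "(1 + r * t) * (1 + r * t) ^ m \<le> ?N ^ Suc m * (1 + r) powr t"
    using N by (simp add: power_divide divide_le_eq mult.commute del: of_nat_Suc)
  then show ?thesis
    using q r by (simp add: powr_minus field_simps del: of_nat_Suc power_Suc)
qed

text \<open>
  Compare with a product of one-dimensional functions: \<open>1 + (x \<bullet> b)\<^sup>2 \<le> (1 + |x|)\<^sup>2\<close> for each
  of the basis vectors \<open>b\<close>.
\<close>

lemma integrable_inverse_power_one_plus_norm:
  "integrable lborel (\<lambda>x::'a::euclidean_space. 1 / (1 + norm x) ^ (2 * DIM('a)))"
proof -
  have "set_integrable lborel (einterval (-\<infinity>) \<infinity>) (\<lambda>x::real. inverse (1 + x\<^sup>2))"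
    by (rule integrable_inverse_1_plus_square)
  then have "integrable lborel (\<lambda>x::real. inverse (1 + x\<^sup>2))"
    by (simp add: set_integrable_def)
  then have i: "integrable lborel (\<lambda>x::'a. \<Prod>b\<in>Basis. inverse (1 + (x \<bullet> b)\<^sup>2))"
    by (rule lborel_integrable_prod_Basis)
  show ?thesis
  proof (rule Bochner_Integration.integrable_bound[OF i])
    show "AE x::'a in lborel. norm (1 / (1 + norm x) ^ (2 * DIM('a)))
        \<le> norm (\<Prod>b\<in>Basis. inverse (1 + (x \<bullet> b)\<^sup>2))"
    proof (rule AE_I2)
      fix x :: 'a
      have "(\<Prod>b\<in>Basis. 1 + (x \<bullet> b)\<^sup>2) \<le> (\<Prod>b\<in>(Basis::'a set). (1 + norm x)\<^sup>2)"
      proof (rule prod_mono, safe)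
        fix b :: 'a assume b: "b \<in> Basis"
        have "(x \<bullet> b)\<^sup>2 \<le> (norm x)\<^sup>2"
          using Basis_le_norm[OF b, of x] by (metis abs_ge_zero power2_abs power_mono)
        moreover have "(1 + norm x)\<^sup>2 = 1 + (norm x)\<^sup>2 + 2 * norm x" by (simp add: power2_sum)
        ultimately show "1 + (x \<bullet> b)\<^sup>2 \<le> (1 + norm x)\<^sup>2" using norm_ge_zero[of x] by linarith
      qed simp
      also have "\<dots> = (1 + norm x) ^ (2 * DIM('a))" by (simp flip: power_mult)
      finally have "inverse ((1 + norm x) ^ (2 * DIM('a))) \<le> inverse (\<Prod>b\<in>Basis. 1 + (x \<bullet> b)\<^sup>2)"
        by (intro le_imp_inverse_le prod_pos) (auto intro!: add_pos_nonneg)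
      then show "norm (1 / (1 + norm x) ^ (2 * DIM('a))) \<le> norm (\<Prod>b\<in>Basis. inverse (1 + (x \<bullet> b)\<^sup>2))"
        by (simp add: abs_prod prod_dividef inverse_eq_divide)
    qed
  qed (auto intro!: borel_measurable_divide borel_measurable_power borel_measurable_add)
qed

lemma
  fixes t :: real
  assumes t: "t > 0"
  shows integrable_scaled_inverse_power:
      "integrable lborel (\<lambda>x::'a::euclidean_space. 1 / (1 + norm x * t) ^ (2 * DIM('a)))"
    and integral_scaled_inverse_power:
      "(LINT x::'a|lborel. 1 / (1 + norm x * t) ^ (2 * DIM('a)))
        = (LINT x::'a|lborel. 1 / (1 + norm x) ^ (2 * DIM('a))) / t ^ DIM('a)"
  using lborel_integrable_affine[OF _ integrable_inverse_power_one_plus_norm, of t 0]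
    lborel_integral_affine[of t "\<lambda>x::'a. 1 / (1 + norm x) ^ (2 * DIM('a))" 0] t
  by (auto simp: mult.commute)

text \<open>
  The moment condition in \<open>L\<^sup>1\<^sup>,\<^sup>1\<close> makes the transform Lipschitz at the origin, by
  \<open>|exp (- i x \<bullet> \<xi>) - 1| \<le> |x| |\<xi>|\<close>.
\<close>

lemma norm_fourier_minus_integral_le:
  fixes f :: "real ^ 'n \<Rightarrow> complex"
  assumes f: "f \<in> L11_space"
  shows "norm (fourier f \<xi> - (LINT x|lborel. f x)) \<le> norm \<xi> * L11_norm f"
proof -
  from f have f1: "integrable lborel f" and f11: "integrable lborel (\<lambda>x. (1 + norm x) * norm (f x))"
    by (auto simp: L11_space_def Lspace_1_iff)
  have [measurable]: "f \<in> borel_measurable borel" using borel_measurable_integrable[OF f1] by simp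
  have "fourier f \<xi> - (LINT x|lborel. f x)
      = (LINT x|lborel. exp (- \<i> * complex_of_real (x \<bullet> \<xi>)) * f x - f x)"
    unfolding fourier_def by (intro Bochner_Integration.integral_diff[symmetric] integrable_exp_times f1)
  also have "norm \<dots> \<le> (LINT x|lborel. norm (exp (- \<i> * complex_of_real (x \<bullet> \<xi>)) * f x - f x))"
    by (rule integral_norm_bound)
  also have "\<dots> \<le> (LINT x|lborel. norm \<xi> * ((1 + norm x) * norm (f x)))"
  proof (rule integral_mono)
    show "integrable lborel (\<lambda>x. norm (exp (- \<i> * complex_of_real (x \<bullet> \<xi>)) * f x - f x))"
      by (intro integrable_norm Bochner_Integration.integrable_diff integrable_exp_times f1)
    show "integrable lborel (\<lambda>x. norm \<xi> * ((1 + norm x) * norm (f x)))"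
      by (intro integrable_mult_right f11)
    fix x :: "real ^ 'n"
    have "norm (iexp (- (x \<bullet> \<xi>)) - 1) \<le> \<bar>x \<bullet> \<xi>\<bar>"
      using iexp_approx1[of "- (x \<bullet> \<xi>)" 0] by simp
    then have "norm (exp (- \<i> * complex_of_real (x \<bullet> \<xi>)) - 1) \<le> \<bar>x \<bullet> \<xi>\<bar>" by simp
    also have "\<dots> \<le> norm x * norm \<xi>" by (rule Cauchy_Schwarz_ineq2)
    also have "\<dots> \<le> norm \<xi> * (1 + norm x)" by (simp add: algebra_simps)
    finally have "norm (exp (- \<i> * complex_of_real (x \<bullet> \<xi>)) - 1) * norm (f x)
        \<le> norm \<xi> * (1 + norm x) * norm (f x)" by (rule mult_right_mono) simp
    then show "norm (exp (- \<i> * complex_of_real (x \<bullet> \<xi>)) * f x - f x) \<le> norm \<xi> * ((1 + norm x) * norm (f x))"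
      by (simp only: norm_mult[symmetric] left_diff_distrib mult_1 mult.assoc)
  qed
  also have "\<dots> = norm \<xi> * L11_norm f" by (simp add: L11_norm_def)
  finally show ?thesis .
qed

text \<open>
  The zero frequency, where the oscillator degenerates, is a null set; everywhere else
  \<open>log (1 + |\<xi>|) < |\<xi>|\<close>, so the oscillator is underdamped.
\<close>

lemma mild_solution_fourier:
  fixes u0 u1 :: "real ^ 'n \<Rightarrow> complex"
  assumes u0: "integrable lborel u0" and u1: "integrable lborel u1" and sol: "mild_solution u0 u1 u"
    and t: "t \<ge> 0"
  obtains g where "has_L2_fourier (u t) g"
    and "AE \<xi> in lborel. g \<xi> = log_damped_solution (norm \<xi>) (fourier u0 \<xi>) (fourier u1 \<xi>) t"
proof -
  from sol obtain v w w' where v: "AE x in lborel. u 0 x = u0 x" "AE x in lborel. v 0 x = u1 x"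
    and w: "\<And>t. t \<ge> 0 \<Longrightarrow> has_L2_fourier (u t) (w t)" "\<And>t. t \<ge> 0 \<Longrightarrow> has_L2_fourier (v t) (w' t)"
    and ode: "AE \<xi> in lborel. \<forall>t\<ge>0.
            ((\<lambda>s. w s \<xi>) has_vector_derivative w' t \<xi>) (at t within {0..}) \<and>
            (\<exists>w''. ((\<lambda>s. w' s \<xi>) has_vector_derivative w'') (at t within {0..}) \<and>
               w'' + 2 * of_real (L_symbol \<xi>) * w' t \<xi> + of_real ((norm \<xi>)\<^sup>2) * w t \<xi> = 0)"
    unfolding mild_solution_def by blast
  have i0: "AE \<xi> in lborel. w 0 \<xi> = fourier u0 \<xi>"
    by (rule has_L2_fourier_AE_eq_fourier_of_AE_eq[OF w(1) u0 v(1)]) simp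
  have i1: "AE \<xi> in lborel. w' 0 \<xi> = fourier u1 \<xi>"
    by (rule has_L2_fourier_AE_eq_fourier_of_AE_eq[OF w(2) u1 v(2)]) simp
  have "AE \<xi> in lborel. w t \<xi> = log_damped_solution (norm \<xi>) (fourier u0 \<xi>) (fourier u1 \<xi>) t"
    using i0 i1 ode AE_lborel_singleton[of "0 :: real ^ 'n"]
  proof eventually_elim
    case (elim \<xi>)
    let ?a = "ln (1 + norm \<xi>)"
    define \<omega> where "\<omega> = sqrt ((norm \<xi>)\<^sup>2 - ?a\<^sup>2)"
    have r: "norm \<xi> > 0" using elim(4) by simp
    have pos: "(norm \<xi>)\<^sup>2 - ?a\<^sup>2 > 0" using log_damping_less_square[OF r] by simp
    then have \<omega>: "\<omega> \<noteq> 0" and sq: "\<omega>\<^sup>2 + ?a\<^sup>2 = (norm \<xi>)\<^sup>2"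
      unfolding \<omega>_def by (simp_all only: real_sqrt_eq_zero_cancel_iff real_sqrt_pow2 less_imp_le)
    have "w t \<xi> = exp (- ?a * t) *\<^sub>R (cos (\<omega> * t) *\<^sub>R w 0 \<xi> + (sin (\<omega> * t) / \<omega>) *\<^sub>R (w' 0 \<xi> + ?a *\<^sub>R w 0 \<xi>))"
      by (rule underdamped_oscillator_solution[where y="\<lambda>s. w s \<xi>" and y'="\<lambda>s. w' s \<xi>", OF \<omega> _ _ t])
        (use elim(3) in \<open>auto simp: sq L_symbol_def\<close>)
    then show ?case using elim(1,2) by (simp add: log_damped_solution_def Let_def \<omega>_def)
  qed
  with w(1)[OF t] show thesis by (rule that)
qed

section \<open>Decay of the solution\<close>

lemma sqrt_power_eq_powr:
  fixes t :: real
  assumes "t > 0"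
  shows "sqrt (t ^ m) = t powr (real m / 2)"
  using powr_half_sqrt_powr[of t "real m"] powr_realpow[OF assms, of m] assms by simp

lemma mult_powr_minus:
  fixes t a :: real
  assumes "t > 0"
  shows "t * t powr (- a) = t powr (1 - a)"
  unfolding diff_conv_add_uminus by (rule powr_mult_base) (use assms in simp)

text \<open>
  Pointwise, \<open>|g \<xi>| \<le> B / (1 + |\<xi>| t) ^ n\<close>: the linear growth in \<open>|\<xi>|\<close> of the transform of \<open>u1\<close> and
  the factor \<open>1 + |\<xi>| t\<close> in front of \<open>u0\<close> are absorbed by the damping.  Here \<open>B\<close> is
  \<open>Lnorm 1 u0 + L11_norm u1 + t * |P1|\<close> up to a constant that depends on \<open>n\<close>.  The substitution
  \<open>\<xi> \<mapsto> \<xi> / t\<close> contributes \<open>t powr (- n)\<close> to the squared norm.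
\<close>

lemma mild_solution_L2_upper_bound:
  fixes u0 u1 :: "real ^ 'n \<Rightarrow> complex"
  defines "m \<equiv> CARD('n)"
  defines "K \<equiv> (LINT x::real ^ 'n|lborel. 1 / (1 + norm x) ^ (2 * m))"
  assumes u0: "u0 \<in> Lspace 1" and u1: "u1 \<in> L11_space" and sol: "mild_solution u0 u1 u"
    and t: "real (Suc m) \<le> t"
  shows "Lnorm 2 (u t) \<le> real (Suc m) ^ Suc m * sqrt K * t powr (- (real m / 2))
      * (Lnorm 1 u0 + L11_norm u1 + t * norm (LINT x|lborel. u1 x))"
proof -
  define P where "P = norm (LINT x|lborel. u1 x)"
  define U0 where "U0 = Lnorm 1 u0"
  define U1 where "U1 = L11_norm u1"
  define B where "B = real (Suc m) ^ Suc m * (U0 + U1 + t * P)"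
  have t0: "t > 0" using t by (rule less_le_trans[rotated]) simp
  have nn: "P \<ge> 0" "U0 \<ge> 0" "U1 \<ge> 0"
    by (simp_all add: P_def U0_def U1_def Lnorm_1_eq L11_norm_def)
  have B: "B \<ge> 0" using nn t0 by (simp add: B_def)
  have i0: "integrable lborel u0" and i1: "integrable lborel u1"
    using u0 u1 by (auto simp: L11_space_def Lspace_1_iff)
  obtain g where g: "has_L2_fourier (u t) g"
    and geq: "AE \<xi> in lborel. g \<xi> = log_damped_solution (norm \<xi>) (fourier u0 \<xi>) (fourier u1 \<xi>) t"
    using mild_solution_fourier[OF i0 i1 sol less_imp_le[OF t0]] by blast
  have bound: "AE \<xi> in lborel. (norm (g \<xi>))\<^sup>2 \<le> B\<^sup>2 * (1 / (1 + norm \<xi> * t) ^ (2 * m))"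
    using geq AE_lborel_singleton[of "0 :: real ^ 'n"]
  proof eventually_elim
    case (elim \<xi>)
    let ?r = "norm \<xi>"
    have r: "?r > 0" using elim(2) by simp
    have rt: "?r * t \<ge> 0" using r t0 by simp
    have f0: "norm (fourier u0 \<xi>) \<le> U0" using norm_fourier_le[of u0 \<xi>] by (simp add: U0_def Lnorm_1_eq)
    have f1: "norm (fourier u1 \<xi>) \<le> P + ?r * U1"
      using norm_fourier_minus_integral_le[OF u1, of \<xi>]
        norm_triangle_ineq2[of "fourier u1 \<xi>" "LINT x|lborel. u1 x"]
      by (simp add: P_def U1_def)
    have "norm (g \<xi>) \<le> (1 + ?r) powr (- t) * ((1 + ?r * t) * norm (fourier u0 \<xi>) + t * norm (fourier u1 \<xi>))"
      unfolding elim(1) by (rule norm_log_damped_solution_le[OF r less_imp_le[OF t0]])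
    also have "\<dots> \<le> (1 + ?r) powr (- t) * ((1 + ?r * t) * U0 + t * (P + ?r * U1))"
      using f0 f1 rt t0 by (intro mult_left_mono add_mono) auto
    also have "\<dots> \<le> (1 + ?r) powr (- t) * ((1 + ?r * t) * (U0 + U1 + t * P))"
    proof (rule mult_left_mono)
      have "0 \<le> U1 + (?r * t) * (t * P)" using rt t0 nn by simp
      then show "(1 + ?r * t) * U0 + t * (P + ?r * U1) \<le> (1 + ?r * t) * (U0 + U1 + t * P)"
        by (simp add: algebra_simps)
    qed simp
    also have "\<dots> = ((1 + ?r) powr (- t) * (1 + ?r * t)) * (U0 + U1 + t * P)" by simp
    also have "\<dots> \<le> (real (Suc m) ^ Suc m / (1 + ?r * t) ^ m) * (U0 + U1 + t * P)"
      using t nn t0 by (intro mult_right_mono powr_minus_le_inverse_power) auto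
    also have "\<dots> = B / (1 + ?r * t) ^ m" by (simp add: B_def)
    finally have "(norm (g \<xi>))\<^sup>2 \<le> (B / (1 + ?r * t) ^ m)\<^sup>2" by (intro power_mono) auto
    then show ?case by (simp add: power_divide mult.commute flip: power_mult)
  qed
  have g2: "integrable lborel (\<lambda>\<xi>. (norm (g \<xi>))\<^sup>2)"
    using g by (auto simp: has_L2_fourier_def Lspace_2_iff)
  have "(LINT x|lborel. (norm (u t x))\<^sup>2) \<le> (2 * pi) ^ m * (LINT x|lborel. (norm (u t x))\<^sup>2)"
  proof -
    have "1 \<le> (2 * pi) ^ m" using pi_gt3 by (intro one_le_power) simp
    then have "1 * (LINT x|lborel. (norm (u t x))\<^sup>2) \<le> (2 * pi) ^ m * (LINT x|lborel. (norm (u t x))\<^sup>2)"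
      by (rule mult_right_mono) simp
    then show ?thesis by simp
  qed
  also have "\<dots> = (LINT \<xi>|lborel. (norm (g \<xi>))\<^sup>2)" using plancherel[OF g] by (simp add: m_def)
  also have "\<dots> \<le> (LINT \<xi>::real ^ 'n|lborel. B\<^sup>2 * (1 / (1 + norm \<xi> * t) ^ (2 * m)))"
    using integrable_scaled_inverse_power[OF t0, where 'a="real ^ 'n"]
    by (intro integral_mono_AE g2 bound integrable_mult_right) (simp add: m_def)
  also have "\<dots> = B\<^sup>2 * K / t ^ m"
    unfolding integral_mult_right_zero
    using integral_scaled_inverse_power[OF t0, where 'a="real ^ 'n"] by (simp add: m_def K_def)
  finally have "Lnorm 2 (u t) \<le> sqrt (B\<^sup>2 * K / t ^ m)"
    unfolding Lnorm_2_eq by (rule real_sqrt_le_mono)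
  also have "\<dots> = B * sqrt K * t powr (- (real m / 2))"
    using B by (simp only: real_sqrt_mult real_sqrt_divide real_sqrt_abs abs_of_nonneg
        sqrt_power_eq_powr[OF t0] powr_minus_divide times_divide_eq_right mult_1_right)
  finally show ?thesis by (simp add: B_def P_def U0_def U1_def mult_ac)
qed

text \<open>
  It is enough to look at the frequencies \<open>|\<xi>| < 1 / t\<close>.  There the transform of the solution
  is at least a multiple of \<open>t |P1|\<close>, and the ball has volume proportional to \<open>t powr (- n)\<close>.
\<close>

lemma mild_solution_L2_lower_bound:
  fixes u0 u1 :: "real ^ 'n \<Rightarrow> complex"
  defines "m \<equiv> CARD('n)"
  assumes u0: "u0 \<in> Lspace 1" and u1: "u1 \<in> L11_space" and sol: "mild_solution u0 u1 u"
    and t: "t > 0" and large: "12 * (L11_norm u1 + 2 * Lnorm 1 u0) \<le> t * norm (LINT x|lborel. u1 x)"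
  shows "sqrt (unit_ball_vol (real m) / (2 * pi) ^ m) / 12 * norm (LINT x|lborel. u1 x)
      * t powr (1 - real m / 2) \<le> Lnorm 2 (u t)"
proof -
  define P where "P = norm (LINT x|lborel. u1 x)"
  define U0 where "U0 = Lnorm 1 u0"
  define U1 where "U1 = L11_norm u1"
  have nn: "P \<ge> 0" "U0 \<ge> 0" "U1 \<ge> 0"
    by (simp_all add: P_def U0_def U1_def Lnorm_1_eq L11_norm_def)
  have i0: "integrable lborel u0" and i1: "integrable lborel u1"
    using u0 u1 by (auto simp: L11_space_def Lspace_1_iff)
  obtain g where g: "has_L2_fourier (u t) g"
    and geq: "AE \<xi> in lborel. g \<xi> = log_damped_solution (norm \<xi>) (fourier u0 \<xi>) (fourier u1 \<xi>) t"
    using mild_solution_fourier[OF i0 i1 sol less_imp_le[OF t]] by blast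
  let ?I = "indicator (ball 0 (1 / t)) :: real ^ 'n \<Rightarrow> real"
  have bound: "AE \<xi> in lborel. (t * P / 12)\<^sup>2 * ?I \<xi> \<le> (norm (g \<xi>))\<^sup>2"
    using geq AE_lborel_singleton[of "0 :: real ^ 'n"]
  proof eventually_elim
    case (elim \<xi>)
    show ?case
    proof (cases "\<xi> \<in> ball 0 (1 / t)")
      case True
      let ?r = "norm \<xi>"
      have r: "?r > 0" using elim(2) by simp
      have rt: "?r * t \<le> 1" using True t by (simp add: pos_less_divide_eq)
      have f0: "norm (fourier u0 \<xi>) \<le> U0" using norm_fourier_le[of u0 \<xi>] by (simp add: U0_def Lnorm_1_eq)
      have f1: "norm (fourier u1 \<xi>) \<ge> P - ?r * U1"
        using norm_fourier_minus_integral_le[OF u1, of \<xi>]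
          norm_triangle_ineq3[of "fourier u1 \<xi>" "LINT x|lborel. u1 x"]
        by (simp add: P_def U1_def)
      have rtU: "(?r * t) * U1 \<le> 1 * U1" using rt nn by (intro mult_right_mono)
      \<comment> \<open>largeness of \<open>t\<close> lets half of the main term pay for all error terms\<close>
      have absorb: "X / 12 \<le> X / 6 - U1 / 6 - 2 * U0" if "12 * (U1 + 2 * U0) \<le> X" for X
        using that nn by (simp add: field_simps)
      have "t * P / 12 \<le> t * P / 6 - U1 / 6 - 2 * U0"
        by (rule absorb) (rule large[folded P_def U0_def U1_def])
      also have "\<dots> \<le> t / 6 * (P - ?r * U1) - 2 * norm (fourier u0 \<xi>)"
        using rtU f0 by (simp add: algebra_simps)
      also have "\<dots> \<le> t / 6 * norm (fourier u1 \<xi>) - 2 * norm (fourier u0 \<xi>)"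
        using f1 t by (intro diff_right_mono mult_left_mono) auto
      also have "\<dots> \<le> norm (g \<xi>)"
        unfolding elim(1) by (rule norm_log_damped_solution_ge[OF r less_imp_le[OF t] rt])
      finally show ?thesis using True nn t by (simp add: power_mono)
    qed simp
  qed
  have g2: "integrable lborel (\<lambda>\<xi>. (norm (g \<xi>))\<^sup>2)"
    using g by (auto simp: has_L2_fourier_def Lspace_2_iff)
  have iI: "integrable lborel ?I"
    by (intro integrable_real_indicator emeasure_lborel_ball_finite) simp
  have vol: "(LINT \<xi>|lborel. ?I \<xi>) = unit_ball_vol (real m) / t ^ m"
    using t content_ball[of "1 / t" "0 :: real ^ 'n"]
    by (simp add: m_def power_divide)
  have "(t * P / 12)\<^sup>2 * (unit_ball_vol (real m) / t ^ m) = (LINT \<xi>|lborel. (t * P / 12)\<^sup>2 * ?I \<xi>)"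
    unfolding integral_mult_right_zero vol ..
  also have "\<dots> \<le> (LINT \<xi>|lborel. (norm (g \<xi>))\<^sup>2)"
    by (intro integral_mono_AE bound g2 integrable_mult_right iI)
  also have "\<dots> = (2 * pi) ^ m * (LINT x|lborel. (norm (u t x))\<^sup>2)"
    using plancherel[OF g] by (simp add: m_def)
  finally have "(t * P / 12)\<^sup>2 * (unit_ball_vol (real m) / t ^ m) / (2 * pi) ^ m \<le> (LINT x|lborel. (norm (u t x))\<^sup>2)"
    by (subst pos_divide_le_eq) (simp_all only: mult.commute zero_less_power zero_less_mult_iff
      pi_gt_zero zero_less_numeral simp_thms)
  then have "(t * P / 12)\<^sup>2 * (unit_ball_vol (real m) / (2 * pi) ^ m) / t ^ m \<le> (LINT x|lborel. (norm (u t x))\<^sup>2)"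
    by (simp only: times_divide_eq_right times_divide_eq_left divide_divide_eq_left mult_ac)
  then have "sqrt ((t * P / 12)\<^sup>2 * (unit_ball_vol (real m) / (2 * pi) ^ m) / t ^ m) \<le> Lnorm 2 (u t)"
    unfolding Lnorm_2_eq by (rule real_sqrt_le_mono)
  moreover have "sqrt ((t * P / 12)\<^sup>2 * (unit_ball_vol (real m) / (2 * pi) ^ m) / t ^ m)
      = t * P / 12 * sqrt (unit_ball_vol (real m) / (2 * pi) ^ m) / sqrt (t ^ m)"
    using t nn by (simp only: real_sqrt_mult real_sqrt_divide real_sqrt_abs) simp
  moreover have "sqrt (t ^ m) = t powr (real m / 2)"
    by (rule sqrt_power_eq_powr[OF t])
  moreover have "t * P / 12 * sqrt (unit_ball_vol (real m) / (2 * pi) ^ m) / t powr (real m / 2)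
      = sqrt (unit_ball_vol (real m) / (2 * pi) ^ m) / 12 * P * t powr (1 - real m / 2)"
    by (simp only: mult_powr_minus[OF t, symmetric] powr_minus divide_inverse mult_ac)
  ultimately show ?thesis by (simp only: P_def)
qed

theorem theorem1p6:
  "\<exists>C1 C2 \<alpha> :: real. C1 > 0 \<and> C2 > 0 \<and> \<alpha> > 0 \<and>
     (\<forall>(u0 :: real ^ 'n \<Rightarrow> complex) u1 u P1.
        u0 \<in> H1_space \<inter> Lspace 1 \<longrightarrow> u1 \<in> Lspace 2 \<inter> L11_space \<longrightarrow>
        P1 = (LINT x|lborel. u1 x) \<longrightarrow> mild_solution u0 u1 u \<longrightarrow>
        (\<exists>t0>0. \<forall>t\<ge>t0.
           C1 * norm P1 * t powr (1 - real CARD('n) / 2) \<le> Lnorm 2 (u t) \<and>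
           Lnorm 2 (u t) \<le> C2 * (L11_norm u1 * t powr (- (real CARD('n) / 2))
                              + Lnorm 1 u0 * t powr (- (real CARD('n) / 2))
                              + norm P1 * t powr (1 - real CARD('n) / 2)
                              + norm P1 * exp (- \<alpha> * t))))"
proof -
  define m where "m = CARD('n)"
  define K where "K = (LINT x::real ^ 'n|lborel. 1 / (1 + norm x) ^ (2 * m))"
  define C1 where "C1 = sqrt (unit_ball_vol (real m) / (2 * pi) ^ m) / 12"
  define D where "D = real (Suc m) ^ Suc m * sqrt K"
  define C2 where "C2 = D + 1"
  have K: "K \<ge> 0" by (simp add: K_def)
  have C1: "C1 > 0" by (simp add: C1_def)
  have D: "D \<ge> 0" unfolding D_def using K by (intro mult_nonneg_nonneg zero_le_power) auto
  then have C2: "C2 > 0" by (simp add: C2_def)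
  \<comment> \<open>the rate \<open>\<alpha> = 1\<close> is a free choice: the other three terms alone dominate the norm\<close>
  show ?thesis
  proof (rule exI[of _ C1], rule exI[of _ C2], rule exI[of _ 1], intro conjI allI impI C1 C2)
    fix u0 u1 :: "real ^ 'n \<Rightarrow> complex" and u P1
    assume "u0 \<in> H1_space \<inter> Lspace 1" "u1 \<in> Lspace 2 \<inter> L11_space"
      and P1: "P1 = (LINT x|lborel. u1 x)" and sol: "mild_solution u0 u1 u"
    then have u0: "u0 \<in> Lspace 1" and u1: "u1 \<in> L11_space" by auto
    let ?U0 = "Lnorm 1 u0" and ?U1 = "L11_norm u1"
    have nn: "?U0 \<ge> 0" "?U1 \<ge> 0" by (simp_all add: Lnorm_1_eq L11_norm_def)
    \<comment> \<open>for \<open>P1 = 0\<close> the quotient is \<open>0\<close>, and the lower bound is trivial\<close>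
    define t0 where "t0 = max (real (Suc m)) (12 * (?U1 + 2 * ?U0) / norm P1)"
    show "\<exists>t0>0. \<forall>t\<ge>t0.
           C1 * norm P1 * t powr (1 - real CARD('n) / 2) \<le> Lnorm 2 (u t) \<and>
           Lnorm 2 (u t) \<le> C2 * (?U1 * t powr (- (real CARD('n) / 2))
                              + ?U0 * t powr (- (real CARD('n) / 2))
                              + norm P1 * t powr (1 - real CARD('n) / 2)
                              + norm P1 * exp (- 1 * t))"
    proof (intro exI[of _ t0] conjI allI impI)
      show "t0 > 0" by (simp add: t0_def less_max_iff_disj)
      fix t assume "t \<ge> t0"
      then have tm: "real (Suc m) \<le> t" and tl: "12 * (?U1 + 2 * ?U0) / norm P1 \<le> t"
        by (auto simp: t0_def)
      have t: "t > 0" using tm by (rule less_le_trans[rotated]) simp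
      show "C1 * norm P1 * t powr (1 - real CARD('n) / 2) \<le> Lnorm 2 (u t)"
      proof (cases "P1 = 0")
        case True
        then show ?thesis by (simp add: Lnorm_2_eq)
      next
        case False
        then have "12 * (?U1 + 2 * ?U0) \<le> t * norm P1" using tl by (simp add: pos_divide_le_eq)
        from mild_solution_L2_lower_bound[OF u0 u1 sol t this[unfolded P1]]
        show ?thesis unfolding C1_def P1 m_def .
      qed
      have tp: "t * t powr (- (real m / 2)) = t powr (1 - real m / 2)"
        by (rule mult_powr_minus[OF t])
      let ?R = "?U1 * t powr (- (real m / 2)) + ?U0 * t powr (- (real m / 2)) + norm P1 * t powr (1 - real m / 2)"
      have "Lnorm 2 (u t) \<le> D * t powr (- (real m / 2)) * (?U0 + ?U1 + t * norm P1)"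
        unfolding P1 D_def m_def K_def
        by (rule mild_solution_L2_upper_bound[OF u0 u1 sol tm[unfolded m_def]])
      also have "\<dots> = D * ?R"
        unfolding tp[symmetric] by (simp only: distrib_left distrib_right add_ac mult_ac)
      also have "\<dots> \<le> C2 * (?R + norm P1 * exp (- 1 * t))"
        using nn D by (intro mult_mono) (auto simp: C2_def)
      finally show "Lnorm 2 (u t) \<le> C2 * (?U1 * t powr (- (real CARD('n) / 2))
                              + ?U0 * t powr (- (real CARD('n) / 2))
                              + norm P1 * t powr (1 - real CARD('n) / 2)
                              + norm P1 * exp (- 1 * t))"
        by (simp add: m_def)
    qed
  qed simp
qed

end
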